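(* Let $\mathcal{I}$ be a small category and $\iota\colon\mathcal{O}\hookrightarrow\mathcal{I}$ the inclusion of a full subcategory. Let $\mathcal{C}$ be a complete and cocomplete category equipped with a factorization system $(\mathcal{E},\mathcal{M})$, and let $\mathcal{L}\colon\mathcal{O}\to\mathcal{C}$ be a functor. Then $\mathsf{Auto}(\mathcal{L})$ has an initial object and a final object, given by the left Kan extension $\mathrm{Lan}_{\iota}\mathcal{L}$ and the right Kan extension $\mathrm{Ran}_{\iota}\mathcal{L}$ of $\mathcal{L}$ along $\iota$, respectively. Furthermore, the minimal $\mathcal{C}$-automaton $\mathsf{Min}(\mathcal{L})$ accepting $\mathcal{L}$ is obtained via the $(\mathcal{E}_{\mathsf{Auto}(\mathcal{L})},\mathcal{M}_{\mathsf{Auto}(\mathcal{L})})$-factorization $$\mathrm{Lan}_{\iota}\mathcal{L}\twoheadrightarrow \mathsf{Min}(\mathcal{L})\rightarrowtail \mathrm{Ran}_{\iota}\mathcal{L}$$ of the unique arrow of $\mathsf{Auto}(\mathcal{L})$ from the initial to the final object.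
   Context: A $\mathcal{C}$-language is a functor $\mathcal{L}\colon\mathcal{O}\to\mathcal{C}$; a $\mathcal{C}$-automaton is a functor $\mathcal{A}\colon\mathcal{I}\to\mathcal{C}$; $\mathcal{A}$ accepts $\mathcal{L}$ when $\mathcal{A}\circ\iota=\mathcal{L}$. The category $\mathsf{Auto}(\mathcal{L})$ is the subcategory of $[\mathcal{I},\mathcal{C}]$ whose objects are the functors $\mathcal{A}$ with $\mathcal{A}\circ\iota=\mathcal{L}$ and whose arrows $\mathcal{A}\to\mathcal{B}$ are the natural transformations $\alpha$ with $\alpha\circ\iota=\mathrm{id}_{\mathcal{L}}$. Kan extensions are taken up to isomorphism, so that (as $\iota$ is full and faithful) they are chosen to restrict strictly to $\mathcal{L}$ when regarded as objects of $\mathsf{Auto}(\mathcal{L})$. "Factorization system" means orthogonal factorization system. The factorization system on $\mathsf{Auto}(\mathcal{L})$ is $(\mathcal{E}_{\mathsf{Auto}(\mathcal{L})},\mathcal{M}_{\mathsf{Auto}(\mathcal{L})})$, where $\mathcal{E}_{\mathsf{Auto}(\mathcal{L})}$ (resp. $\mathcal{M}_{\mathsf{Auto}(\mathcal{L})}$) consists of the arrows of $\mathsf{Auto}(\mathcal{L})$ all of whose components lie in $\mathcal{E}$ (resp. $\mathcal{M}$). Arrows $\twoheadrightarrow$ and $\rightarrowtail$ denote arrows of these two classes. In a category with a factorization system $(E,M)$, an object $X$ $(E,M)$-divides $Y$ if $X$ is an $E$-quotient of an $M$-subobject of $Y$, i.e. there are an object $Z$, an arrow $Z\to Y$ in $M$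 and an arrow $Z\to X$ in $E$. An object is $(E,M)$-minimal (here: a minimal automaton for $\mathcal{L}$, when the category is $\mathsf{Auto}(\mathcal{L})$ with the factorization system $(\mathcal{E}_{\mathsf{Auto}(\mathcal{L})},\mathcal{M}_{\mathsf{Auto}(\mathcal{L})})$) if it $(E,M)$-divides every object of the category. *)

theory Defs
  imports "HOL-Library.FuncSet" "HOL-Library.Equipollence"
begin

section \<open>Categories\<close>

record ('o, 'a) cat =
  Ob :: "'o set"
  Ar :: "'a set"
  Dom :: "'a \<Rightarrow> 'o"
  Cod :: "'a \<Rightarrow> 'o"
  Ide :: "'o \<Rightarrow> 'a"
  Comp :: "'a \<Rightarrow> 'a \<Rightarrow> 'a"  \<comment> \<open>\<open>Comp C g f\<close> is \<open>g\<close> after \<open>f\<close>\<close>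

definition Hom :: "('o, 'a) cat \<Rightarrow> 'o \<Rightarrow> 'o \<Rightarrow> 'a set" where
  "Hom C x y = {f \<in> Ar C. Dom C f = x \<and> Cod C f = y}"

locale category =
  fixes C :: "('o, 'a) cat"
  assumes Dom_in_Ob: "f \<in> Ar C \<Longrightarrow> Dom C f \<in> Ob C"
    and Cod_in_Ob: "f \<in> Ar C \<Longrightarrow> Cod C f \<in> Ob C"
    and Ide_in_Hom: "x \<in> Ob C \<Longrightarrow> Ide C x \<in> Hom C x x"
    and Comp_in_Hom: "\<lbrakk>f \<in> Hom C x y; g \<in> Hom C y z\<rbrakk> \<Longrightarrow> Comp C g f \<in> Hom C x z"
    and Comp_Ide: "f \<in> Hom C x y \<Longrightarrow> Comp C f (Ide C x) = f"
    and Ide_Comp: "f \<in> Hom C x y \<Longrightarrow> Comp C (Ide C y) f = f"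
    and Comp_assoc: "\<lbrakk>f \<in> Hom C w x; g \<in> Hom C x y; h \<in> Hom C y z\<rbrakk>
      \<Longrightarrow> Comp C h (Comp C g f) = Comp C (Comp C h g) f"

definition iso_arrow :: "('o, 'a) cat \<Rightarrow> 'a \<Rightarrow> bool" where
  "iso_arrow C f \<longleftrightarrow> f \<in> Ar C \<and>
     (\<exists>g \<in> Hom C (Cod C f) (Dom C f).
        Comp C g f = Ide C (Dom C f) \<and> Comp C f g = Ide C (Cod C f))"

definition initial :: "('o, 'a) cat \<Rightarrow> 'o \<Rightarrow> bool" where
  "initial C x \<longleftrightarrow> x \<in> Ob C \<and> (\<forall>y \<in> Ob C. \<exists>!f. f \<in> Hom C x y)"

definition final :: "('o, 'a) cat \<Rightarrow> 'o \<Rightarrow> bool" where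
  "final C x \<longleftrightarrow> x \<in> Ob C \<and> (\<forall>y \<in> Ob C. \<exists>!f. f \<in> Hom C y x)"

definition full_subcat :: "('o, 'a) cat \<Rightarrow> 'o set \<Rightarrow> ('o, 'a) cat" where
  "full_subcat C S = C\<lparr>Ob := S, Ar := {f \<in> Ar C. Dom C f \<in> S \<and> Cod C f \<in> S}\<rparr>"


section \<open>Functors and natural transformations\<close>

text \<open>The object and arrow maps of a functor, and the family of components of a natural
  transformation, are extensional (they take the value \<open>undefined\<close> outside the source category).
  Equality in the types below is therefore equality of functors and of natural transformations.\<close>

record ('o1, 'a1, 'o2, 'a2) func =
  FOb :: "'o1 \<Rightarrow> 'o2"
  FAr :: "'a1 \<Rightarrow> 'a2"

locale cat_functor = A: category A + B: category B
  for A :: "('o1, 'a1) cat" and B :: "('o2, 'a2) cat" and F :: "('o1, 'a1, 'o2, 'a2) func" +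
  assumes FOb_in: "FOb F \<in> Ob A \<rightarrow>\<^sub>E Ob B"
    and FAr_extensional: "FAr F \<in> extensional (Ar A)"
    and FAr_in_Hom: "f \<in> Hom A x y \<Longrightarrow> FAr F f \<in> Hom B (FOb F x) (FOb F y)"
    and FAr_Ide: "x \<in> Ob A \<Longrightarrow> FAr F (Ide A x) = Ide B (FOb F x)"
    and FAr_Comp: "\<lbrakk>f \<in> Hom A x y; g \<in> Hom A y z\<rbrakk>
      \<Longrightarrow> FAr F (Comp A g f) = Comp B (FAr F g) (FAr F f)"

definition fcomp ::
  "('o1, 'a1) cat \<Rightarrow> ('o2, 'a2, 'o3, 'a3) func \<Rightarrow> ('o1, 'a1, 'o2, 'a2) func
    \<Rightarrow> ('o1, 'a1, 'o3, 'a3) func" where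
  "fcomp A G F = \<lparr>FOb = compose (Ob A) (FOb G) (FOb F), FAr = compose (Ar A) (FAr G) (FAr F)\<rparr>"

definition inclusion :: "('o, 'a) cat \<Rightarrow> ('o, 'a, 'o, 'a) func" where
  "inclusion A = \<lparr>FOb = (\<lambda>x \<in> Ob A. x), FAr = (\<lambda>f \<in> Ar A. f)\<rparr>"

record ('o1, 'a1, 'o2, 'a2) ntrans =
  NDom :: "('o1, 'a1, 'o2, 'a2) func"
  NCod :: "('o1, 'a1, 'o2, 'a2) func"
  NComp :: "'o1 \<Rightarrow> 'a2"

locale nat_trans =
  F: cat_functor A B "NDom \<alpha>" + G: cat_functor A B "NCod \<alpha>"
  for A :: "('o1, 'a1) cat" and B :: "('o2, 'a2) cat" and \<alpha> :: "('o1, 'a1, 'o2, 'a2) ntrans" +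
  assumes NComp_in: "NComp \<alpha> \<in> (\<Pi>\<^sub>E x \<in> Ob A. Hom B (FOb (NDom \<alpha>) x) (FOb (NCod \<alpha>) x))"
    and naturality: "f \<in> Hom A x y
      \<Longrightarrow> Comp B (NComp \<alpha> y) (FAr (NDom \<alpha>) f) = Comp B (FAr (NCod \<alpha>) f) (NComp \<alpha> x)"

definition functor_cat ::
  "('o1, 'a1) cat \<Rightarrow> ('o2, 'a2) cat
    \<Rightarrow> (('o1, 'a1, 'o2, 'a2) func, ('o1, 'a1, 'o2, 'a2) ntrans) cat" where
  "functor_cat A B =
    \<lparr>Ob = {F. cat_functor A B F},
     Ar = {\<alpha>. nat_trans A B \<alpha>},
     Dom = NDom,
     Cod = NCod,
     Ide = (\<lambda>F. \<lparr>NDom = F, NCod = F, NComp = (\<lambda>x \<in> Ob A. Ide B (FOb F x))\<rparr>),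
     Comp = (\<lambda>\<beta> \<alpha>. \<lparr>NDom = NDom \<alpha>, NCod = NCod \<beta>,
                     NComp = (\<lambda>x \<in> Ob A. Comp B (NComp \<beta> x) (NComp \<alpha> x))\<rparr>)\<rparr>"

text \<open>\<open>whisker A \<alpha> K\<close> is \<open>\<alpha> \<circ> K\<close>, where \<open>K\<close> is a functor with source \<open>A\<close>.\<close>

definition whisker ::
  "('o1, 'a1) cat \<Rightarrow> ('o2, 'a2, 'o3, 'a3) ntrans \<Rightarrow> ('o1, 'a1, 'o2, 'a2) func
    \<Rightarrow> ('o1, 'a1, 'o3, 'a3) ntrans" where
  "whisker A \<alpha> K =
    \<lparr>NDom = fcomp A (NDom \<alpha>) K,
     NCod = fcomp A (NCod \<alpha>) K,
     NComp = compose (Ob A) (NComp \<alpha>) (FOb K)\<rparr>"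


section \<open>Smallness, completeness and cocompleteness\<close>

text \<open>Size is measured against a set \<open>U\<close>, which plays the role of a universe: a collection is
  small iff its cardinality is strictly below that of \<open>U\<close>. For a Grothendieck universe \<open>U\<close> these are
  the collections in bijection with an element of \<open>U\<close>. Every small category is isomorphic to one
  whose objects and arrows are elements of \<open>U\<close>, so that (co)completeness need only mention such
  index categories.\<close>

definition small_cat :: "'u set \<Rightarrow> ('o, 'a) cat \<Rightarrow> bool" where
  "small_cat U C \<longleftrightarrow> category C \<and> Ob C \<prec> U \<and> Ar C \<prec> U"

definition is_cone ::
  "('o1, 'a1) cat \<Rightarrow> ('o2, 'a2) cat \<Rightarrow> ('o1, 'a1, 'o2, 'a2) func \<Rightarrow> 'o2 \<Rightarrow> ('o1 \<Rightarrow> 'a2) \<Rightarrow> bool"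
  where
  "is_cone J C D x p \<longleftrightarrow> x \<in> Ob C \<and> (\<forall>j \<in> Ob J. p j \<in> Hom C x (FOb D j)) \<and>
     (\<forall>i j. \<forall>f \<in> Hom J i j. Comp C (FAr D f) (p i) = p j)"

definition is_limit ::
  "('o1, 'a1) cat \<Rightarrow> ('o2, 'a2) cat \<Rightarrow> ('o1, 'a1, 'o2, 'a2) func \<Rightarrow> 'o2 \<Rightarrow> ('o1 \<Rightarrow> 'a2) \<Rightarrow> bool"
  where
  "is_limit J C D x p \<longleftrightarrow> is_cone J C D x p \<and>
     (\<forall>y q. is_cone J C D y q \<longrightarrow> (\<exists>!u. u \<in> Hom C y x \<and> (\<forall>j \<in> Ob J. Comp C (p j) u = q j)))"

definition is_cocone ::
  "('o1, 'a1) cat \<Rightarrow> ('o2, 'a2) cat \<Rightarrow> ('o1, 'a1, 'o2, 'a2) func \<Rightarrow> 'o2 \<Rightarrow> ('o1 \<Rightarrow> 'a2) \<Rightarrow> bool"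
  where
  "is_cocone J C D x p \<longleftrightarrow> x \<in> Ob C \<and> (\<forall>j \<in> Ob J. p j \<in> Hom C (FOb D j) x) \<and>
     (\<forall>i j. \<forall>f \<in> Hom J i j. Comp C (p j) (FAr D f) = p i)"

definition is_colimit ::
  "('o1, 'a1) cat \<Rightarrow> ('o2, 'a2) cat \<Rightarrow> ('o1, 'a1, 'o2, 'a2) func \<Rightarrow> 'o2 \<Rightarrow> ('o1 \<Rightarrow> 'a2) \<Rightarrow> bool"
  where
  "is_colimit J C D x p \<longleftrightarrow> is_cocone J C D x p \<and>
     (\<forall>y q. is_cocone J C D y q \<longrightarrow> (\<exists>!u. u \<in> Hom C x y \<and> (\<forall>j \<in> Ob J. Comp C u (p j) = q j)))"

definition complete_cat :: "'u set \<Rightarrow> ('o, 'a) cat \<Rightarrow> bool" where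
  "complete_cat U C \<longleftrightarrow> category C \<and>
     (\<forall>(J :: ('u, 'u) cat) D. small_cat U J \<and> Ob J \<subseteq> U \<and> Ar J \<subseteq> U \<and> cat_functor J C D
        \<longrightarrow> (\<exists>x p. is_limit J C D x p))"

definition cocomplete_cat :: "'u set \<Rightarrow> ('o, 'a) cat \<Rightarrow> bool" where
  "cocomplete_cat U C \<longleftrightarrow> category C \<and>
     (\<forall>(J :: ('u, 'u) cat) D. small_cat U J \<and> Ob J \<subseteq> U \<and> Ar J \<subseteq> U \<and> cat_functor J C D
        \<longrightarrow> (\<exists>x p. is_colimit J C D x p))"


section \<open>Kan extensions\<close>

text \<open>\<open>(R, \<eta>)\<close> is a left Kan extension of \<open>F : A \<rightarrow> C\<close> along \<open>K : A \<rightarrow> B\<close>, with unit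
  \<open>\<eta> : F \<Rightarrow> R \<circ> K\<close>; dually, \<open>(R, \<epsilon>)\<close> is a right Kan extension, with counit
  \<open>\<epsilon> : R \<circ> K \<Rightarrow> F\<close>.\<close>

definition left_kan ::
  "('o1, 'a1) cat \<Rightarrow> ('o2, 'a2) cat \<Rightarrow> ('o3, 'a3) cat
    \<Rightarrow> ('o1, 'a1, 'o2, 'a2) func \<Rightarrow> ('o1, 'a1, 'o3, 'a3) func
    \<Rightarrow> ('o2, 'a2, 'o3, 'a3) func \<Rightarrow> ('o1, 'a1, 'o3, 'a3) ntrans \<Rightarrow> bool" where
  "left_kan A B C K F R \<eta> \<longleftrightarrow>
     R \<in> Ob (functor_cat B C) \<and> \<eta> \<in> Hom (functor_cat A C) F (fcomp A R K) \<and>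
     (\<forall>G \<in> Ob (functor_cat B C). \<forall>\<gamma> \<in> Hom (functor_cat A C) F (fcomp A G K).
        \<exists>!\<delta>. \<delta> \<in> Hom (functor_cat B C) R G \<and> Comp (functor_cat A C) (whisker A \<delta> K) \<eta> = \<gamma>)"

definition right_kan ::
  "('o1, 'a1) cat \<Rightarrow> ('o2, 'a2) cat \<Rightarrow> ('o3, 'a3) cat
    \<Rightarrow> ('o1, 'a1, 'o2, 'a2) func \<Rightarrow> ('o1, 'a1, 'o3, 'a3) func
    \<Rightarrow> ('o2, 'a2, 'o3, 'a3) func \<Rightarrow> ('o1, 'a1, 'o3, 'a3) ntrans \<Rightarrow> bool" where
  "right_kan A B C K F R \<epsilon> \<longleftrightarrow>
     R \<in> Ob (functor_cat B C) \<and> \<epsilon> \<in> Hom (functor_cat A C) (fcomp A R K) F \<and>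
     (\<forall>G \<in> Ob (functor_cat B C). \<forall>\<gamma> \<in> Hom (functor_cat A C) (fcomp A G K) F.
        \<exists>!\<delta>. \<delta> \<in> Hom (functor_cat B C) G R \<and> Comp (functor_cat A C) \<epsilon> (whisker A \<delta> K) = \<gamma>)"


section \<open>Orthogonal factorization systems and minimal objects\<close>

definition is_factorization ::
  "('o, 'a) cat \<Rightarrow> 'a set \<Rightarrow> 'a set \<Rightarrow> 'a \<Rightarrow> 'a \<Rightarrow> 'o \<Rightarrow> 'a \<Rightarrow> bool" where
  "is_factorization C E M f e z m \<longleftrightarrow>
     e \<in> E \<inter> Hom C (Dom C f) z \<and> m \<in> M \<inter> Hom C z (Cod C f) \<and> f = Comp C m e"

locale factorization_system = category C
  for C :: "('o, 'a) cat" and E M :: "'a set" +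
  assumes E_arrows: "E \<subseteq> Ar C"
    and M_arrows: "M \<subseteq> Ar C"
    and E_iso: "iso_arrow C f \<Longrightarrow> f \<in> E"
    and M_iso: "iso_arrow C f \<Longrightarrow> f \<in> M"
    and E_Comp: "\<lbrakk>f \<in> E; g \<in> E; Cod C f = Dom C g\<rbrakk> \<Longrightarrow> Comp C g f \<in> E"
    and M_Comp: "\<lbrakk>f \<in> M; g \<in> M; Cod C f = Dom C g\<rbrakk> \<Longrightarrow> Comp C g f \<in> M"
    and factorization_exists: "f \<in> Ar C \<Longrightarrow> \<exists>e z m. is_factorization C E M f e z m"
    and orthogonality:
      "\<lbrakk>e \<in> E; m \<in> M; u \<in> Hom C (Dom C e) (Dom C m); v \<in> Hom C (Cod C e) (Cod C m);
        Comp C m u = Comp C v e\<rbrakk>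
       \<Longrightarrow> \<exists>!d. d \<in> Hom C (Cod C e) (Dom C m) \<and> Comp C d e = u \<and> Comp C m d = v"

definition divides :: "('o, 'a) cat \<Rightarrow> 'a set \<Rightarrow> 'a set \<Rightarrow> 'o \<Rightarrow> 'o \<Rightarrow> bool" where
  "divides C E M x y \<longleftrightarrow> (\<exists>z \<in> Ob C. (\<exists>m \<in> M. m \<in> Hom C z y) \<and> (\<exists>e \<in> E. e \<in> Hom C z x))"

definition minimal :: "('o, 'a) cat \<Rightarrow> 'a set \<Rightarrow> 'a set \<Rightarrow> 'o \<Rightarrow> bool" where
  "minimal C E M x \<longleftrightarrow> x \<in> Ob C \<and> (\<forall>y \<in> Ob C. divides C E M x y)"


section \<open>Automata\<close>

text \<open>\<open>Auto \<O> \<I> \<iota> \<C> \<L>\<close> is the category of \<open>\<C>\<close>-automata \<open>\<I> \<rightarrow> \<C>\<close> accepting the language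
  \<open>\<L> : \<O> \<rightarrow> \<C>\<close>. The condition on an arrow \<open>\<alpha>\<close> includes that its source and target restrict to \<open>\<L>\<close>,
  since a natural transformation carries its source and target.\<close>

definition Auto ::
  "('o1, 'a1) cat \<Rightarrow> ('o2, 'a2) cat \<Rightarrow> ('o1, 'a1, 'o2, 'a2) func \<Rightarrow> ('o3, 'a3) cat
    \<Rightarrow> ('o1, 'a1, 'o3, 'a3) func
    \<Rightarrow> (('o2, 'a2, 'o3, 'a3) func, ('o2, 'a2, 'o3, 'a3) ntrans) cat" where
  "Auto \<O> \<I> \<iota> \<C> \<L> =
     (functor_cat \<I> \<C>)
       \<lparr>Ob := {A \<in> Ob (functor_cat \<I> \<C>). fcomp \<O> A \<iota> = \<L>},
        Ar := {\<alpha> \<in> Ar (functor_cat \<I> \<C>). whisker \<O> \<alpha> \<iota> = Ide (functor_cat \<O> \<C>) \<L>}\<rparr>"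

definition auto_class ::
  "('o1, 'a1) cat \<Rightarrow> ('o2, 'a2) cat \<Rightarrow> ('o1, 'a1, 'o2, 'a2) func \<Rightarrow> ('o3, 'a3) cat
    \<Rightarrow> ('o1, 'a1, 'o3, 'a3) func \<Rightarrow> 'a3 set \<Rightarrow> ('o2, 'a2, 'o3, 'a3) ntrans set" where
  "auto_class \<O> \<I> \<iota> \<C> \<L> X = {\<alpha> \<in> Ar (Auto \<O> \<I> \<iota> \<C> \<L>). \<forall>x \<in> Ob \<I>. NComp \<alpha> x \<in> X}"

end

(*
  A limit over the comma category i / iota can be chosen to be L i whenever i lies in the full
  subcategory, since the identity of i is then initial in it. Pointwise Kan extensions built from
  these choices restrict strictly to L, and their universal property with the identity as unit says
  that they are initial and final among automata. The factorization system is componentwise: the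
  diagonal fillers make the middle objects into a functor, and choosing id = id . id on the
  subcategory keeps it an automaton. Minimality of the factorization of initial -> final is then a
  formal fact about any category with a factorization system.
*)
theory Submission
  imports Defs
begin

section \<open>Categories and duality\<close>

text \<open>The obstacle is strictness. An automaton restricts to \<open>L\<close> on the nose,
  while limits and factorizations are fixed only up to isomorphism, so every choice has to be made
  rigid over \<open>S\<close>, for arrows as well as for objects. Conversely, a Kan extension that
  does restrict to \<open>L\<close> may still come with a unit other than the identity. Comparing it
  with one strict extension shows that its unit is invertible, which lets the statement speak about
  every Kan extension lying in the category of automata. The main constructions are carried out on
  one side only and transported through opposite categories. For this, \<open>natural_family\<close>
  and \<open>extends_L\<close> avoid the ends recorded in \<open>ntrans\<close>, so that they
  dualize by plain rewriting. Size matters because an arrow of a comma category is a pair of arrows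
  of \<open>I\<close>: for infinite \<open>U\<close>, such pairs stay below
  \<open>U\<close>.\<close>

context category
begin

text \<open>Composability is phrased through \<open>Dom\<close> and \<open>Cod\<close> rather than
  \<open>Hom\<close>, whose middle object simplification could not guess. The other arrow forms
  follow the same pattern.\<close>

lemma arrow_Comp [simp]:
  assumes "f \<in> Ar C" "g \<in> Ar C" "Dom C g = Cod C f"
  shows "Comp C g f \<in> Ar C" "Dom C (Comp C g f) = Dom C f" "Cod C (Comp C g f) = Cod C g"
  using Comp_in_Hom[of f "Dom C f" "Cod C f" g "Cod C g"] assms by (auto simp: Hom_def)

lemma arrow_Ide [simp]:
  assumes "x \<in> Ob C"
  shows "Ide C x \<in> Ar C" "Dom C (Ide C x) = x" "Cod C (Ide C x) = x"
  using Ide_in_Hom[OF assms] by (auto simp: Hom_def)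

lemma Comp_Ide_arrow [simp]: "f \<in> Ar C \<Longrightarrow> Dom C f = x \<Longrightarrow> Comp C f (Ide C x) = f"
  using Comp_Ide by (auto simp: Hom_def)

lemma Ide_Comp_arrow [simp]: "f \<in> Ar C \<Longrightarrow> Cod C f = x \<Longrightarrow> Comp C (Ide C x) f = f"
  using Ide_Comp by (auto simp: Hom_def)

lemma Comp_assoc_arrow:
  assumes "f \<in> Ar C" "g \<in> Ar C" "h \<in> Ar C" "Dom C g = Cod C f" "Dom C h = Cod C g"
  shows "Comp C (Comp C h g) f = Comp C h (Comp C g f)"
  using Comp_assoc[of f "Dom C f" "Cod C f" g "Cod C g" h "Cod C h"] assms by (auto simp: Hom_def)

lemma Ob_Dom_Cod [simp]: "f \<in> Ar C \<Longrightarrow> Dom C f \<in> Ob C" "f \<in> Ar C \<Longrightarrow> Cod C f \<in> Ob C"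
  by (rule Dom_in_Ob Cod_in_Ob, assumption)+

lemma iso_arrow_Ide: "x \<in> Ob C \<Longrightarrow> iso_arrow C (Ide C x)"
  unfolding iso_arrow_def by (auto intro!: bexI[of _ "Ide C x"] simp: Hom_def)

end

lemma category_arrowI:
  assumes "\<And>f. f \<in> Ar C \<Longrightarrow> Dom C f \<in> Ob C \<and> Cod C f \<in> Ob C"
    and "\<And>x. x \<in> Ob C \<Longrightarrow> Ide C x \<in> Ar C \<and> Dom C (Ide C x) = x \<and> Cod C (Ide C x) = x"
    and "\<And>f g. f \<in> Ar C \<Longrightarrow> g \<in> Ar C \<Longrightarrow> Dom C g = Cod C f \<Longrightarrow>
      Comp C g f \<in> Ar C \<and> Dom C (Comp C g f) = Dom C f \<and> Cod C (Comp C g f) = Cod C g"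
    and "\<And>f. f \<in> Ar C \<Longrightarrow> Comp C f (Ide C (Dom C f)) = f \<and> Comp C (Ide C (Cod C f)) f = f"
    and "\<And>f g h. f \<in> Ar C \<Longrightarrow> g \<in> Ar C \<Longrightarrow> h \<in> Ar C \<Longrightarrow> Dom C g = Cod C f \<Longrightarrow>
      Dom C h = Cod C g \<Longrightarrow> Comp C h (Comp C g f) = Comp C (Comp C h g) f"
  shows "category C"
  using assms by unfold_locales (auto simp: Hom_def)

lemma full_subcat_simps [simp]:
  "Ob (full_subcat C S) = S"
  "Ar (full_subcat C S) = {f \<in> Ar C. Dom C f \<in> S \<and> Cod C f \<in> S}"
  "Dom (full_subcat C S) = Dom C" "Cod (full_subcat C S) = Cod C"
  "Ide (full_subcat C S) = Ide C" "Comp (full_subcat C S) = Comp C"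
  by (simp_all add: full_subcat_def)

section \<open>Opposite categories and the transfer of functors, limits and completeness\<close>

definition op_cat :: "('o, 'a) cat \<Rightarrow> ('o, 'a) cat" where
  "op_cat C = \<lparr>Ob = Ob C, Ar = Ar C, Dom = Cod C, Cod = Dom C, Ide = Ide C,
    Comp = (\<lambda>g f. Comp C f g)\<rparr>"

lemma op_cat_simps [simp]:
  "Ob (op_cat C) = Ob C" "Ar (op_cat C) = Ar C" "Dom (op_cat C) = Cod C" "Cod (op_cat C) = Dom C"
  "Ide (op_cat C) = Ide C" "Comp (op_cat C) g f = Comp C f g" "op_cat (op_cat C) = C"
  "Hom (op_cat C) x y = Hom C y x"
  by (auto simp: op_cat_def Hom_def)

lemma op_cat_full_subcat: "op_cat (full_subcat C S) = full_subcat (op_cat C) S"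
  by (auto simp: op_cat_def full_subcat_def)

lemma category_op_cat: "category C \<Longrightarrow> category (op_cat C)"
  by (rule category_arrowI) (auto simp: category.arrow_Comp category.arrow_Ide
    category.Comp_Ide_arrow category.Ide_Comp_arrow category.Ob_Dom_Cod category.Comp_assoc_arrow)

lemma cat_functor_op_cat:
  assumes "cat_functor A B F"
  shows "cat_functor (op_cat A) (op_cat B) F"
proof -
  interpret cat_functor A B F by fact
  show ?thesis
    using category_op_cat[OF A.category_axioms] category_op_cat[OF B.category_axioms]
      FOb_in FAr_extensional FAr_Ide FAr_Comp FAr_in_Hom
    by (auto simp: cat_functor_def cat_functor_axioms_def)
qed

lemma op_cat_functor_iff: "cat_functor (op_cat A) (op_cat B) G \<longleftrightarrow> cat_functor A B G"
  using cat_functor_op_cat[of A B G] cat_functor_op_cat[of "op_cat A" "op_cat B" G] by auto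

lemma small_cat_op_cat: "small_cat U C \<Longrightarrow> small_cat U (op_cat C)"
  by (auto simp: small_cat_def category_op_cat)

lemma is_limit_op_cat: "is_limit (op_cat J) (op_cat C) D x p \<longleftrightarrow> is_colimit J C D x p"
  unfolding is_limit_def is_colimit_def is_cone_def is_cocone_def by (simp, blast)

text \<open>A diagram over \<open>J\<close> in \<open>op_cat C\<close> is a diagram over
  \<open>op_cat J\<close> in \<open>C\<close>. The opposite index category has the same objects and
  arrows, so it is still small and inside \<open>U\<close>.\<close>

lemma complete_cat_op_cat:
  assumes "cocomplete_cat U C"
  shows "complete_cat U (op_cat C)"
  unfolding complete_cat_def
proof (intro conjI allI impI)
  show "category (op_cat C)"
    using assms by (auto simp: cocomplete_cat_def category_op_cat)
next
  fix J :: "('a, 'a) cat" and D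
  assume J: "small_cat U J \<and> Ob J \<subseteq> U \<and> Ar J \<subseteq> U \<and> cat_functor J (op_cat C) D"
  then have "cat_functor (op_cat J) C D"
    using cat_functor_op_cat[of J "op_cat C" D] by simp
  with J assms have "\<exists>x p. is_colimit (op_cat J) C D x p"
    by (simp add: cocomplete_cat_def small_cat_op_cat)
  then show "\<exists>x p. is_limit J (op_cat C) D x p"
    using is_limit_op_cat[of "op_cat J" C D] by simp
qed

context cat_functor
begin

lemma FOb_Ob [simp]: "x \<in> Ob A \<Longrightarrow> FOb F x \<in> Ob B"
  using FOb_in by auto

lemma FAr_arrow [simp]:
  assumes "f \<in> Ar A"
  shows "FAr F f \<in> Ar B" "Dom B (FAr F f) = FOb F (Dom A f)" "Cod B (FAr F f) = FOb F (Cod A f)"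
  using FAr_in_Hom[of f "Dom A f" "Cod A f"] assms by (auto simp: Hom_def)

lemma FAr_Comp_arrow:
  "f \<in> Ar A \<Longrightarrow> g \<in> Ar A \<Longrightarrow> Dom A g = Cod A f \<Longrightarrow>
    FAr F (Comp A g f) = Comp B (FAr F g) (FAr F f)"
  using FAr_Comp[of f "Dom A f" "Cod A f" g "Cod A g"] by (auto simp: Hom_def)

end

lemma cat_functor_arrowI:
  assumes "category A" "category B"
    and "FOb F \<in> extensional (Ob A)" "FAr F \<in> extensional (Ar A)"
    and "\<And>x. x \<in> Ob A \<Longrightarrow> FOb F x \<in> Ob B"
    and "\<And>f. f \<in> Ar A \<Longrightarrow> FAr F f \<in> Hom B (FOb F (Dom A f)) (FOb F (Cod A f))"
    and "\<And>x. x \<in> Ob A \<Longrightarrow> FAr F (Ide A x) = Ide B (FOb F x)"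
    and "\<And>f g. f \<in> Ar A \<Longrightarrow> g \<in> Ar A \<Longrightarrow> Dom A g = Cod A f \<Longrightarrow>
      FAr F (Comp A g f) = Comp B (FAr F g) (FAr F f)"
  shows "cat_functor A B F"
  using assms unfolding cat_functor_def cat_functor_axioms_def
  by (auto simp: Hom_def PiE_def)

section \<open>Limits of small diagrams\<close>

text \<open>Completeness as defined only speaks of index categories inside \<open>U\<close>; a small category of
  any type is moved there along injections of its objects and arrows.\<close>

definition image_cat :: "('o \<Rightarrow> 'p) \<Rightarrow> ('a \<Rightarrow> 'b) \<Rightarrow> ('o, 'a) cat \<Rightarrow> ('p, 'b) cat" where
  "image_cat a b J = \<lparr>Ob = a ` Ob J, Ar = b ` Ar J,
     Dom = (\<lambda>f. a (Dom J (inv_into (Ar J) b f))),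
     Cod = (\<lambda>f. a (Cod J (inv_into (Ar J) b f))),
     Ide = (\<lambda>x. b (Ide J (inv_into (Ob J) a x))),
     Comp = (\<lambda>g f. b (Comp J (inv_into (Ar J) b g) (inv_into (Ar J) b f)))\<rparr>"

lemma limit_of_small_diagram:
  fixes U :: "'u set" and J :: "('o, 'a) cat"
  assumes "complete_cat U C" "small_cat U J" "cat_functor J C D"
  shows "\<exists>x p. is_limit J C D x p"
proof -
  interpret D: cat_functor J C D by fact
  obtain a where a: "inj_on a (Ob J)" "a ` Ob J \<subseteq> U"
    using assms(2) by (auto simp: small_cat_def lesspoll_def lepoll_def)
  obtain b where b: "inj_on b (Ar J)" "b ` Ar J \<subseteq> U"
    using assms(2) by (auto simp: small_cat_def lesspoll_def lepoll_def)
  let ?J = "image_cat a b J"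
  have inv [simp]: "inv_into (Ob J) a (a x) = x" if "x \<in> Ob J" for x
    using a(1) that by simp
  have invb [simp]: "inv_into (Ar J) b (b x) = x" if "x \<in> Ar J" for x
    using b(1) that by simp
  have J_simps: "Ob ?J = a ` Ob J" "Ar ?J = b ` Ar J"
    "f \<in> Ar J \<Longrightarrow> Dom ?J (b f) = a (Dom J f)" "f \<in> Ar J \<Longrightarrow> Cod ?J (b f) = a (Cod J f)"
    "x \<in> Ob J \<Longrightarrow> Ide ?J (a x) = b (Ide J x)"
    "f \<in> Ar J \<Longrightarrow> g \<in> Ar J \<Longrightarrow> Comp ?J (b g) (b f) = b (Comp J g f)" for f g x
    by (auto simp: image_cat_def)
  have a_eq: "a x = a y \<longleftrightarrow> x = y" if "x \<in> Ob J" "y \<in> Ob J" for x y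
    using a(1) that by (auto dest: inj_onD)
  have b_eq: "b f = b g \<longleftrightarrow> f = g" if "f \<in> Ar J" "g \<in> Ar J" for f g
    using b(1) that by (auto dest: inj_onD)
  have cat: "category ?J"
    by (rule category_arrowI) (auto simp: J_simps a_eq D.A.Comp_assoc_arrow)
  have "Ob ?J \<approx> Ob J" "Ar ?J \<approx> Ar J"
    using a(1) b(1) by (auto simp: J_simps inj_on_image_eqpoll_self)
  then have small: "small_cat U ?J"
    using cat assms(2) by (auto simp: small_cat_def dest: eq_lesspoll_trans)
  let ?D = "\<lparr>FOb = (\<lambda>x \<in> a ` Ob J. FOb D (inv_into (Ob J) a x)),
    FAr = (\<lambda>f \<in> b ` Ar J. FAr D (inv_into (Ar J) b f))\<rparr>"
  have "cat_functor ?J C ?D"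
    by (rule cat_functor_arrowI[OF cat D.B.category_axioms])
      (auto simp: J_simps a_eq b_eq D.FAr_Comp_arrow D.FAr_Ide Hom_def)
  then obtain x p where lim: "is_limit ?J C ?D x p"
    using assms(1) small a b unfolding complete_cat_def by (fastforce simp: J_simps)
  \<comment> \<open>Cones keep their apex and only have their legs renamed along \<open>a\<close>;
    hence the limit over \<open>?J\<close> is already one over \<open>J\<close>.\<close>
  have cone: "is_cone ?J C ?D y q \<longleftrightarrow> is_cone J C D y (\<lambda>j. q (a j))" for y q
    unfolding is_cone_def by (auto simp: J_simps Hom_def)
  have "is_limit J C D x (\<lambda>j. p (a j))"
    unfolding is_limit_def
  proof (intro conjI allI impI)
    show "is_cone J C D x (\<lambda>j. p (a j))"
      using lim cone by (auto simp: is_limit_def)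
    fix y q
    assume q: "is_cone J C D y q"
    have "is_cone ?J C ?D y (\<lambda>j. q (inv_into (Ob J) a j))"
      unfolding cone using q by (auto simp: is_cone_def Hom_def)
    then have "\<exists>!u. u \<in> Hom C y x \<and>
        (\<forall>j \<in> Ob ?J. Comp C (p j) u = q (inv_into (Ob J) a j))"
      using lim unfolding is_limit_def by blast
    then show "\<exists>!u. u \<in> Hom C y x \<and> (\<forall>j \<in> Ob J. Comp C (p (a j)) u = q j)"
      by (simp add: J_simps)
  qed
  then show ?thesis by blast
qed

text \<open>An infinite \<open>A\<close> is equipollent to its square; for finite \<open>A\<close>
  the square is finite and \<open>U\<close> is not. This bounds the arrows of comma
  categories.\<close>

lemma Times_self_lesspoll:
  assumes "infinite U" "A \<prec> U"
  shows "A \<times> A \<prec> U"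
proof (cases "finite A")
  case True
  then show ?thesis
    using assms(1) by (meson finite_SigmaI finite_lesspoll_infinite)
next
  case False
  then have "A \<times> A \<approx> A"
    using card_of_Times_same_infinite eqpoll_iff_card_of_ordIso by blast
  then show ?thesis
    using assms(2) eq_lesspoll_trans by blast
qed

section \<open>Automata as strict extensions\<close>

text \<open>A natural transformation reduced to its components. Only the values of \<open>F\<close>
  and \<open>G\<close> on \<open>A\<close> enter, so a functor on a larger category can stand in for
  its restriction to \<open>A\<close>.\<close>

definition natural_family ::
  "('o1, 'a1) cat \<Rightarrow> ('o2, 'a2) cat \<Rightarrow> ('o1, 'a1, 'o2, 'a2) func \<Rightarrow> ('o1, 'a1, 'o2, 'a2) func
    \<Rightarrow> ('o1 \<Rightarrow> 'a2) \<Rightarrow> bool" where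
  "natural_family A B F G t \<longleftrightarrow>
     t \<in> (\<Pi>\<^sub>E x \<in> Ob A. Hom B (FOb F x) (FOb G x)) \<and>
     (\<forall>f \<in> Ar A. Comp B (t (Cod A f)) (FAr F f) = Comp B (FAr G f) (t (Dom A f)))"

lemma natural_family_arrow:
  assumes "natural_family A B F G t" "x \<in> Ob A"
  shows "t x \<in> Ar B" "Dom B (t x) = FOb F x" "Cod B (t x) = FOb G x"
  using assms by (auto simp: natural_family_def Hom_def PiE_def)

lemma natural_family_naturality:
  "natural_family A B F G t \<Longrightarrow> f \<in> Ar A \<Longrightarrow>
    Comp B (t (Cod A f)) (FAr F f) = Comp B (FAr G f) (t (Dom A f))"
  by (auto simp: natural_family_def)

lemma natural_family_eqI:
  assumes "natural_family A B F G s" "natural_family A B F G t"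
    and "\<And>x. x \<in> Ob A \<Longrightarrow> s x = t x"
  shows "s = t"
  using assms by (auto simp: natural_family_def intro: PiE_ext)

text \<open>Unique existence says that a set is a singleton, that is, has cardinality one, and
  bijections preserve this. It moves universal properties between transformations with recorded ends
  and bare families.\<close>

lemma bij_betw_Ex1_iff:
  assumes "bij_betw f A B"
  shows "(\<exists>!x. x \<in> A) \<longleftrightarrow> (\<exists>!y. y \<in> B)"
proof -
  have "(\<exists>!x. x \<in> A) \<longleftrightarrow> is_singleton A" "(\<exists>!y. y \<in> B) \<longleftrightarrow> is_singleton B"
    by (auto simp: is_singleton_def)
  then show ?thesis
    using bij_betw_same_card[OF assms] by (simp add: is_singleton_altdef)
qed

lemma natural_family_op_cat:
  "natural_family (op_cat A) (op_cat B) G F t \<longleftrightarrow> natural_family A B F G t"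
  by (auto simp: natural_family_def)

lemma natural_family_cong:
  assumes "category A"
    and "\<And>x. x \<in> Ob A \<Longrightarrow> FOb F x = FOb F' x" "\<And>f. f \<in> Ar A \<Longrightarrow> FAr F f = FAr F' f"
    and "\<And>x. x \<in> Ob A \<Longrightarrow> FOb G x = FOb G' x" "\<And>f. f \<in> Ar A \<Longrightarrow> FAr G f = FAr G' f"
  shows "natural_family A B F G t \<longleftrightarrow> natural_family A B F' G' t"
  using assms by (simp add: natural_family_def cong: PiE_cong)

lemma natural_family_Ide:
  assumes "cat_functor A B F"
  shows "natural_family A B F F (\<lambda>x \<in> Ob A. Ide B (FOb F x))"
proof -
  interpret F: cat_functor A B F by fact
  show ?thesis by (auto simp: natural_family_def Hom_def)
qed

lemma natural_family_Comp:
  assumes "cat_functor A B F" "cat_functor A B G" "cat_functor A B H"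
    and s: "natural_family A B F G s" and t: "natural_family A B G H t"
  shows "natural_family A B F H (\<lambda>x \<in> Ob A. Comp B (t x) (s x))"
proof -
  interpret F: cat_functor A B F by fact
  interpret G: cat_functor A B G by fact
  interpret H: cat_functor A B H by fact
  have nat: "Comp B (Comp B (t (Cod A f)) (s (Cod A f))) (FAr F f) =
      Comp B (FAr H f) (Comp B (t (Dom A f)) (s (Dom A f)))" if f: "f \<in> Ar A" for f
  proof -
    have "Comp B (Comp B (t (Cod A f)) (s (Cod A f))) (FAr F f) =
        Comp B (t (Cod A f)) (Comp B (FAr G f) (s (Dom A f)))"
      using f natural_family_naturality[OF s f]
      by (simp add: F.B.Comp_assoc_arrow natural_family_arrow[OF s] natural_family_arrow[OF t])
    also have "\<dots> = Comp B (Comp B (FAr H f) (t (Dom A f))) (s (Dom A f))"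
      using f natural_family_naturality[OF t f]
      by (simp add: F.B.Comp_assoc_arrow[symmetric] natural_family_arrow[OF s]
        natural_family_arrow[OF t])
    finally show ?thesis
      using f by (simp add: F.B.Comp_assoc_arrow natural_family_arrow[OF s] natural_family_arrow[OF t])
  qed
  then show ?thesis
    by (auto simp: natural_family_def Hom_def natural_family_arrow[OF s] natural_family_arrow[OF t])
qed

lemma Hom_functor_cat:
  "\<alpha> \<in> Hom (functor_cat A B) F G \<longleftrightarrow>
    cat_functor A B F \<and> cat_functor A B G \<and> NDom \<alpha> = F \<and> NCod \<alpha> = G \<and>
    natural_family A B F G (NComp \<alpha>)"
  by (auto simp: Hom_def functor_cat_def nat_trans_def nat_trans_axioms_def natural_family_def)

lemma Ex1_Hom_functor_cat:
  assumes "cat_functor A B F" "cat_functor A B G"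
  shows "(\<exists>!\<delta>. \<delta> \<in> Hom (functor_cat A B) F G \<and> P (NComp \<delta>)) \<longleftrightarrow>
    (\<exists>!t. natural_family A B F G t \<and> P t)"
proof -
  have "bij_betw NComp {\<delta> \<in> Hom (functor_cat A B) F G. P (NComp \<delta>)}
      {t. natural_family A B F G t \<and> P t}"
    by (rule bij_betw_byWitness[where f' = "\<lambda>t. \<lparr>NDom = F, NCod = G, NComp = t\<rparr>"])
      (use assms in \<open>auto simp: Hom_functor_cat\<close>)
  from bij_betw_Ex1_iff[OF this] show ?thesis by simp
qed

text \<open>The category of outputs is \<open>full_subcat I S\<close>. Completeness and
  cocompleteness are kept out of the locale so that its assumptions are self-dual.\<close>

locale language = I: category I + C: category C
  for I :: "('io, 'ia) cat" and C :: "('co, 'ca) cat" +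
  fixes S :: "'io set" and L :: "('io, 'ia, 'co, 'ca) func"
  assumes S_subset: "S \<subseteq> Ob I"
    and L_functor: "cat_functor (full_subcat I S) C L"
begin

sublocale L: cat_functor "full_subcat I S" C L
  by (rule L_functor)

lemma S_Ob [simp]: "x \<in> S \<Longrightarrow> x \<in> Ob I"
  using S_subset by auto

text \<open>The acceptance condition in pointwise form, which the simplifier can use and which does
  not change under opposites; \<open>fcomp_inclusion_eq_L\<close> gives the equivalence.\<close>

definition extends_L :: "('io, 'ia, 'co, 'ca) func \<Rightarrow> bool" where
  "extends_L A \<longleftrightarrow> cat_functor I C A \<and> (\<forall>x \<in> S. FOb A x = FOb L x) \<and>
     (\<forall>f \<in> Ar I. Dom I f \<in> S \<longrightarrow> Cod I f \<in> S \<longrightarrow> FAr A f = FAr L f)"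

text \<open>A right Kan extension whose counit is the identity: composing with the counit
  disappears, and the factorization condition becomes agreement of \<open>\<delta>\<close> with
  \<open>\<gamma>\<close> on \<open>S\<close>.\<close>

definition strict_right_extension :: "('io, 'ia, 'co, 'ca) func \<Rightarrow> bool" where
  "strict_right_extension R \<longleftrightarrow> extends_L R \<and>
     (\<forall>G \<gamma>. cat_functor I C G \<longrightarrow> natural_family (full_subcat I S) C G L \<gamma> \<longrightarrow>
        (\<exists>!\<delta>. natural_family I C G R \<delta> \<and> (\<forall>x \<in> S. \<delta> x = \<gamma> x)))"

definition strict_left_extension :: "('io, 'ia, 'co, 'ca) func \<Rightarrow> bool" where
  "strict_left_extension R \<longleftrightarrow> extends_L R \<and>
     (\<forall>G \<gamma>. cat_functor I C G \<longrightarrow> natural_family (full_subcat I S) C L G \<gamma> \<longrightarrow>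
        (\<exists>!\<delta>. natural_family I C R G \<delta> \<and> (\<forall>x \<in> S. \<delta> x = \<gamma> x)))"

text \<open>In the comma category \<open>i \<down> \<iota>\<close> an arrow is given by its source \<open>f\<close> and an arrow \<open>g\<close>
  of \<open>I\<close> starting at the codomain of \<open>f\<close>; its target is then the composite \<open>g \<circ> f\<close>.\<close>

definition comma :: "'io \<Rightarrow> ('ia, 'ia \<times> 'ia) cat" where
  "comma i = \<lparr>Ob = {f \<in> Ar I. Dom I f = i \<and> Cod I f \<in> S},
     Ar = {(f, g). f \<in> Ar I \<and> Dom I f = i \<and> Cod I f \<in> S \<and> g \<in> Ar I \<and> Dom I g = Cod I f \<and>
       Cod I g \<in> S},
     Dom = fst, Cod = (\<lambda>(f, g). Comp I g f), Ide = (\<lambda>f. (f, Ide I (Cod I f))),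
     Comp = (\<lambda>(f', g') (f, g). (f, Comp I g' g))\<rparr>"

text \<open>The codomain projection of the comma category followed by \<open>L\<close>; its limit is
  the value at \<open>i\<close> of the pointwise right Kan extension.\<close>

definition diagram :: "'io \<Rightarrow> ('ia, 'ia \<times> 'ia, 'co, 'ca) func" where
  "diagram i = \<lparr>FOb = (\<lambda>f \<in> Ob (comma i). FOb L (Cod I f)),
     FAr = (\<lambda>(f, g) \<in> Ar (comma i). FAr L g)\<rparr>"

lemma category_comma: "category (comma i)"
  by (rule category_arrowI) (auto simp: comma_def I.Comp_assoc_arrow)

lemma small_cat_comma:
  assumes "infinite U" "small_cat U I"
  shows "small_cat U (comma i)"
proof -
  have "Ob (comma i) \<lesssim> Ar I" "Ar (comma i) \<lesssim> Ar I \<times> Ar I"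
    by (auto intro!: subset_imp_lepoll simp: comma_def)
  moreover have "Ar I \<prec> U" "Ar I \<times> Ar I \<prec> U"
    using assms Times_self_lesspoll by (auto simp: small_cat_def)
  ultimately show ?thesis
    using category_comma by (auto simp: small_cat_def intro: lesspoll_trans1)
qed

lemma cat_functor_diagram: "cat_functor (comma i) C (diagram i)"
  by (rule cat_functor_arrowI[OF category_comma C.category_axioms])
    (auto simp: diagram_def comma_def Hom_def L.FAr_Ide[simplified] L.FAr_Comp_arrow[simplified])

lemma is_cone_diagram:
  "is_cone (comma i) C (diagram i) y q \<longleftrightarrow> y \<in> Ob C \<and>
    (\<forall>f \<in> Ar I. Dom I f = i \<longrightarrow> Cod I f \<in> S \<longrightarrow> q f \<in> Hom C y (FOb L (Cod I f))) \<and>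
    (\<forall>f \<in> Ar I. \<forall>g \<in> Ar I. Dom I f = i \<longrightarrow> Cod I f \<in> S \<longrightarrow> Dom I g = Cod I f \<longrightarrow> Cod I g \<in> S \<longrightarrow>
      Comp C (FAr L g) (q f) = q (Comp I g f))"
  unfolding is_cone_def by (auto simp: diagram_def comma_def Hom_def)

text \<open>As \<open>\<iota>\<close> is full and faithful, \<open>i \<in> S\<close> makes the identity of \<open>i\<close> initial in \<open>i \<down> \<iota>\<close>.\<close>

lemma is_limit_diagram_in_S:
  assumes "i \<in> S"
  shows "is_limit (comma i) C (diagram i) (FOb L i) (FAr L)"
  unfolding is_limit_def
proof (intro conjI allI impI)
  show "is_cone (comma i) C (diagram i) (FOb L i) (FAr L)"
    using assms by (auto simp: is_cone_diagram Hom_def L.FAr_Comp_arrow[simplified])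
  fix y q
  assume q: "is_cone (comma i) C (diagram i) y q"
  have u: "q (Ide I i) \<in> Hom C y (FOb L i)"
    using q assms unfolding is_cone_diagram by (metis I.arrow_Ide S_Ob)
  show "\<exists>!u. u \<in> Hom C y (FOb L i) \<and> (\<forall>f \<in> Ob (comma i). Comp C (FAr L f) u = q f)"
  \<comment> \<open>The leg at the initial object determines a cone: compatibility with the arrow
    \<open>(Ide I i, f)\<close> yields the leg at \<open>f\<close>.\<close>
  proof (intro ex1I[of _ "q (Ide I i)"] conjI ballI)
    fix f assume "f \<in> Ob (comma i)"
    then have "f \<in> Ar I" "Dom I f = i" "Cod I f \<in> S"
      by (auto simp: comma_def)
    then show "Comp C (FAr L f) (q (Ide I i)) = q f"
      using q assms by (auto simp: is_cone_diagram)
  next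
    fix v assume v: "v \<in> Hom C y (FOb L i) \<and> (\<forall>f \<in> Ob (comma i). Comp C (FAr L f) v = q f)"
    then have "Comp C (FAr L (Ide I i)) v = q (Ide I i)"
      using assms by (auto simp: comma_def)
    then show "v = q (Ide I i)"
      using v assms L.FAr_Ide[of i] by (simp add: Hom_def)
  qed (rule u)
qed

text \<open>Everything is forced by the projections \<open>p i f\<close>: arrows into a limit vertex
  are constructed from cones and compared leg by leg, which gives functoriality, naturality and
  uniqueness alike.\<close>

lemma strict_right_extension_exists:
  assumes "\<And>i. i \<in> Ob I \<Longrightarrow> \<exists>x p. is_limit (comma i) C (diagram i) x p"
  shows "\<exists>R. strict_right_extension R"
proof -
  \<comment> \<open>Over \<open>S\<close> the projections are prescribed together with the vertex.
    Fixing the vertex alone would give the right objects, but not the right action on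
    arrows.\<close>
  have "\<exists>x p. is_limit (comma i) C (diagram i) x p \<and> (i \<in> S \<longrightarrow> x = FOb L i \<and> p = FAr L)"
    if "i \<in> Ob I" for i
    using assms[OF that] is_limit_diagram_in_S[of i] by (cases "i \<in> S") auto
  then obtain r p where lim: "\<And>i. i \<in> Ob I \<Longrightarrow> is_limit (comma i) C (diagram i) (r i) (p i)"
    and rS: "\<And>i. i \<in> S \<Longrightarrow> r i = FOb L i" and pS: "\<And>i. i \<in> S \<Longrightarrow> p i = FAr L"
    by (metis S_Ob)
  have Ob_comma: "f \<in> Ob (comma i) \<longleftrightarrow> f \<in> Ar I \<and> Dom I f = i \<and> Cod I f \<in> S" for f i
    by (simp add: comma_def)
  have r [simp]: "r i \<in> Ob C" if "i \<in> Ob I" for i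
    using lim[OF that] by (auto simp: is_limit_def is_cone_def)
  have p [simp]: "p i f \<in> Ar C" "Dom C (p i f) = r i" "Cod C (p i f) = FOb L (Cod I f)"
    if "f \<in> Ar I" "Dom I f = i" "Cod I f \<in> S" for i f
    using lim[of i] that by (auto simp: is_limit_def is_cone_diagram Hom_def)
  have p_Comp: "Comp C (FAr L g) (p i f) = p i (Comp I g f)"
    if "f \<in> Ar I" "Dom I f = i" "Cod I f \<in> S" "g \<in> Ar I" "Dom I g = Cod I f" "Cod I g \<in> S" for i f g
    using lim[of i] that by (auto simp: is_limit_def is_cone_diagram)
  have p_cone: "is_cone (comma i) C (diagram i) (Dom C u) (\<lambda>f. Comp C (p i f) u)"
    if "u \<in> Ar C" "Cod C u = r i" "i \<in> Ob I" for i u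
    unfolding is_cone_diagram using that
    by (auto simp: Hom_def C.Comp_assoc_arrow[symmetric] p_Comp)
  have lim_ex: "\<exists>u \<in> Hom C y (r i). \<forall>f \<in> Ob (comma i). Comp C (p i f) u = q f"
    if "is_cone (comma i) C (diagram i) y q" "i \<in> Ob I" for y q i
    using lim[of i] that unfolding is_limit_def by blast
  \<comment> \<open>The projections of a limit are jointly monic.\<close>
  have lim_eq: "u = v"
    if "u \<in> Ar C" "v \<in> Ar C" "Cod C u = r i" "Cod C v = r i" "Dom C u = Dom C v" "i \<in> Ob I"
      and "\<And>f. f \<in> Ar I \<Longrightarrow> Dom I f = i \<Longrightarrow> Cod I f \<in> S \<Longrightarrow> Comp C (p i f) u = Comp C (p i f) v"
    for u v i
  proof -
    have "\<exists>!w. w \<in> Hom C (Dom C u) (r i) \<and>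
        (\<forall>f \<in> Ob (comma i). Comp C (p i f) w = Comp C (p i f) u)"
      using lim[OF that(6)] p_cone[OF that(1,3,6)] unfolding is_limit_def by blast
    moreover have "u \<in> Hom C (Dom C u) (r i)" "v \<in> Hom C (Dom C u) (r i)"
      using that by (auto simp: Hom_def)
    ultimately show ?thesis
      using that(7) Ob_comma by metis
  qed
  \<comment> \<open>Precomposition with \<open>h\<close> turns an object \<open>f\<close> of
    \<open>comma (Cod I h)\<close> into an object of \<open>comma (Dom I h)\<close>; reindexing the
    projections in this way gives a cone, and its mediating arrow is the action on
    \<open>h\<close>.\<close>
  have "\<exists>u. u \<in> Hom C (r (Dom I h)) (r (Cod I h)) \<and>
      (\<forall>f \<in> Ob (comma (Cod I h)). Comp C (p (Cod I h) f) u = p (Dom I h) (Comp I f h))"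
    if "h \<in> Ar I" for h
    unfolding Bex_def[symmetric]
    by (rule lim_ex)
      (use that in \<open>auto simp: is_cone_diagram Hom_def p_Comp I.Comp_assoc_arrow\<close>)
  then have "\<forall>h \<in> Ar I. \<exists>u. u \<in> Hom C (r (Dom I h)) (r (Cod I h)) \<and>
      (\<forall>f \<in> Ob (comma (Cod I h)). Comp C (p (Cod I h) f) u = p (Dom I h) (Comp I f h))"
    by blast
  then obtain a where a: "\<forall>h \<in> Ar I. a h \<in> Hom C (r (Dom I h)) (r (Cod I h)) \<and>
      (\<forall>f \<in> Ob (comma (Cod I h)). Comp C (p (Cod I h) f) (a h) = p (Dom I h) (Comp I f h))"
    unfolding bchoice_iff by blast
  have a_Hom: "a h \<in> Hom C (r (Dom I h)) (r (Cod I h))" if "h \<in> Ar I" for h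
    using a that by blast
  have p_a: "Comp C (p (Cod I h) f) (a h) = p (Dom I h) (Comp I f h)"
    if "h \<in> Ar I" "f \<in> Ar I" "Dom I f = Cod I h" "Cod I f \<in> S" for h f
    using a that Ob_comma by blast
  have a [simp]: "a h \<in> Ar C" "Dom C (a h) = r (Dom I h)" "Cod C (a h) = r (Cod I h)"
    if "h \<in> Ar I" for h
    using a_Hom[OF that] by (auto simp: Hom_def)
  \<comment> \<open>The projection at the identity of an object of \<open>S\<close> is
    \<open>L\<close> of that identity, hence an identity. So the action on an arrow ending in
    \<open>S\<close> is itself a projection; if the arrow also starts in \<open>S\<close>, it is the
    value of \<open>L\<close>.\<close>
  have a_p: "a f = p (Dom I f) f" if "f \<in> Ar I" "Cod I f \<in> S" for f
    using p_a[of f "Ide I (Cod I f)"] that L.FAr_Ide[of "Cod I f"] by (simp add: pS rS)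
  let ?R = "\<lparr>FOb = (\<lambda>i \<in> Ob I. r i), FAr = (\<lambda>h \<in> Ar I. a h)\<rparr>"
  have R: "cat_functor I C ?R"
  proof (rule cat_functor_arrowI[OF I.category_axioms C.category_axioms])
    fix x assume x: "x \<in> Ob I"
    have "a (Ide I x) = Ide C (r x)"
      by (rule lim_eq[where i = x]) (use x p_a[of "Ide I x"] in auto)
    then show "FAr ?R (Ide I x) = Ide C (FOb ?R x)"
      using x by simp
  next
    fix f g assume fg: "f \<in> Ar I" "g \<in> Ar I" "Dom I g = Cod I f"
    have "a (Comp I g f) = Comp C (a g) (a f)"
    proof (rule lim_eq[where i = "Cod I g"])
      fix k assume k: "k \<in> Ar I" "Dom I k = Cod I g" "Cod I k \<in> S"
      show "Comp C (p (Cod I g) k) (a (Comp I g f)) = Comp C (p (Cod I g) k) (Comp C (a g) (a f))"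
        using k fg p_a[of "Comp I g f" k] p_a[of f "Comp I k g"]
        by (simp add: C.Comp_assoc_arrow[symmetric] I.Comp_assoc_arrow p_a)
    qed (use fg in auto)
    then show "FAr ?R (Comp I g f) = Comp C (FAr ?R g) (FAr ?R f)"
      using fg by simp
  qed (auto simp: Hom_def)
  have "extends_L ?R"
    using R by (auto simp: extends_L_def rS a_p pS)
  moreover have "\<exists>!\<delta>. natural_family I C G ?R \<delta> \<and> (\<forall>x \<in> S. \<delta> x = \<gamma> x)"
    if G: "cat_functor I C G" and \<gamma>: "natural_family (full_subcat I S) C G L \<gamma>" for G \<gamma>
  proof -
    interpret G: cat_functor I C G by fact
    have \<gamma>_arrow [simp]: "\<gamma> x \<in> Ar C" "Dom C (\<gamma> x) = FOb G x" "Cod C (\<gamma> x) = FOb L x"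
      if "x \<in> S" for x
      using natural_family_arrow[OF \<gamma>, of x] that by auto
    have \<gamma>_nat: "Comp C (FAr L f) (\<gamma> (Dom I f)) = Comp C (\<gamma> (Cod I f)) (FAr G f)"
      if "f \<in> Ar I" "Dom I f \<in> S" "Cod I f \<in> S" for f
      using natural_family_naturality[OF \<gamma>, of f] that by auto
    have "\<exists>u \<in> Hom C (FOb G i) (r i).
        \<forall>f \<in> Ob (comma i). Comp C (p i f) u = Comp C (\<gamma> (Cod I f)) (FAr G f)"
      if i: "i \<in> Ob I" for i
    proof (rule lim_ex[OF _ i])
      \<comment> \<open>The leg at \<open>f\<close> first applies \<open>G\<close> to move along
        \<open>f\<close> into \<open>S\<close>, where \<open>\<gamma>\<close> is available.\<close>
      show "is_cone (comma i) C (diagram i) (FOb G i) (\<lambda>f. Comp C (\<gamma> (Cod I f)) (FAr G f))"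
        unfolding is_cone_diagram
      proof (intro conjI ballI impI)
        fix f g assume fg: "f \<in> Ar I" "g \<in> Ar I" "Dom I f = i" "Cod I f \<in> S" "Dom I g = Cod I f"
          "Cod I g \<in> S"
        then show "Comp C (FAr L g) (Comp C (\<gamma> (Cod I f)) (FAr G f)) =
            Comp C (\<gamma> (Cod I (Comp I g f))) (FAr G (Comp I g f))"
          using \<gamma>_nat[of g] by (simp add: C.Comp_assoc_arrow[symmetric] G.FAr_Comp_arrow)
      qed (use i in \<open>auto simp: Hom_def\<close>)
    qed
    then have "\<forall>i \<in> Ob I. \<exists>u. u \<in> Hom C (FOb G i) (r i) \<and>
        (\<forall>f \<in> Ob (comma i). Comp C (p i f) u = Comp C (\<gamma> (Cod I f)) (FAr G f))"
      unfolding Bex_def by (intro ballI)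
    then obtain d where d: "\<forall>i \<in> Ob I. d i \<in> Hom C (FOb G i) (r i) \<and>
        (\<forall>f \<in> Ob (comma i). Comp C (p i f) (d i) = Comp C (\<gamma> (Cod I f)) (FAr G f))"
      unfolding bchoice_iff by blast
    have d_Hom: "d i \<in> Hom C (FOb G i) (r i)" if "i \<in> Ob I" for i
      by (rule conjunct1[OF bspec[OF d that]])
    have p_d: "Comp C (p (Dom I f) f) (d (Dom I f)) = Comp C (\<gamma> (Cod I f)) (FAr G f)"
      if "f \<in> Ar I" "Cod I f \<in> S" for f
    proof -
      have "Dom I f \<in> Ob I" "f \<in> Ob (comma (Dom I f))"
        using that by (auto simp: Ob_comma)
      then show ?thesis
        by (rule bspec[OF conjunct2[OF bspec[OF d]]])
    qed
    have d [simp]: "d i \<in> Ar C" "Dom C (d i) = FOb G i" "Cod C (d i) = r i" if "i \<in> Ob I" for i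
      using d_Hom[OF that] by (auto simp: Hom_def)
    have d_nat: "Comp C (d (Cod I h)) (FAr G h) = Comp C (a h) (d (Dom I h))" if h: "h \<in> Ar I" for h
    proof (rule lim_eq[where i = "Cod I h"])
      fix f assume f: "f \<in> Ar I" "Dom I f = Cod I h" "Cod I f \<in> S"
      have "Comp C (p (Cod I h) f) (Comp C (d (Cod I h)) (FAr G h)) =
          Comp C (Comp C (p (Cod I h) f) (d (Cod I h))) (FAr G h)"
        using f h by (simp add: C.Comp_assoc_arrow)
      also have "\<dots> = Comp C (Comp C (\<gamma> (Cod I f)) (FAr G f)) (FAr G h)"
        using f p_d[of f] by simp
      also have "\<dots> = Comp C (\<gamma> (Cod I f)) (FAr G (Comp I f h))"
        using f h by (simp add: C.Comp_assoc_arrow G.FAr_Comp_arrow)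
      also have "\<dots> = Comp C (p (Dom I h) (Comp I f h)) (d (Dom I h))"
        using f h p_d[of "Comp I f h"] by simp
      also have "\<dots> = Comp C (Comp C (p (Cod I h) f) (a h)) (d (Dom I h))"
        using f h p_a[of h f] by simp
      also have "\<dots> = Comp C (p (Cod I h) f) (Comp C (a h) (d (Dom I h)))"
        using f h by (simp add: C.Comp_assoc_arrow)
      finally show "Comp C (p (Cod I h) f) (Comp C (d (Cod I h)) (FAr G h)) =
          Comp C (p (Cod I h) f) (Comp C (a h) (d (Dom I h)))" .
    qed (use h in auto)
    \<comment> \<open>The leg equation at the identity, where both the projection and the image
      under \<open>G\<close> are identities.\<close>
    have d_\<gamma>: "d x = \<gamma> x" if "x \<in> S" for x
      using p_d[of "Ide I x"] that L.FAr_Ide[of x] by (simp add: pS rS G.FAr_Ide)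
    have "natural_family I C G ?R (restrict d (Ob I))"
      using d_Hom d_nat by (auto simp: natural_family_def)
    moreover have "\<delta> = restrict d (Ob I)"
      if \<delta>: "natural_family I C G ?R \<delta>" "\<forall>x \<in> S. \<delta> x = \<gamma> x" for \<delta>
    proof (rule natural_family_eqI[OF \<delta>(1) \<open>natural_family I C G ?R (restrict d (Ob I))\<close>])
      fix i assume i: "i \<in> Ob I"
      have "\<delta> i = d i"
      proof (rule lim_eq[where i = i])
        fix f assume f: "f \<in> Ar I" "Dom I f = i" "Cod I f \<in> S"
        \<comment> \<open>The projection is the action on \<open>f\<close> by \<open>a_p\<close>, so
          naturality of the competitor at \<open>f\<close> pushes it to the codomain of
          \<open>f\<close>, where it equals \<open>\<gamma>\<close>.\<close>
        have "Comp C (p i f) (\<delta> i) = Comp C (\<gamma> (Cod I f)) (FAr G f)"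
          using f natural_family_naturality[OF \<delta>(1) f(1)] \<delta>(2) by (simp add: a_p)
        then show "Comp C (p i f) (\<delta> i) = Comp C (p i f) (d i)"
          using f p_d[of f] by simp
      qed (use i natural_family_arrow[OF \<delta>(1) i] in auto)
      then show "\<delta> i = restrict d (Ob I) i"
        using i by simp
    qed
    moreover have "\<forall>x \<in> S. restrict d (Ob I) x = \<gamma> x"
      using d_\<gamma> by simp
    ultimately show ?thesis
      by (intro ex1I[of _ "restrict d (Ob I)"]) (rule conjI, assumption+, elim conjE)
  qed
  ultimately have "strict_right_extension ?R"
    by (simp add: strict_right_extension_def)
  then show ?thesis by blast
qed

lemma complete_strict_right_extension:
  assumes "infinite U" "small_cat U I" "complete_cat U C"
  shows "\<exists>R. strict_right_extension R"
  by (rule strict_right_extension_exists)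
    (rule limit_of_small_diagram[OF assms(3) small_cat_comma[OF assms(1,2)] cat_functor_diagram])

text \<open>Opposites leave the data \<open>S\<close> and \<open>L\<close> unchanged, since a
  functor is the same pair of maps on both sides. Every fact of the locale thus has a dual instance,
  in which left and right extensions trade places.\<close>

lemma language_op_cat: "language (op_cat I) (op_cat C) S L"
  using category_op_cat[OF I.category_axioms] category_op_cat[OF C.category_axioms] S_subset
    cat_functor_op_cat[OF L_functor]
  by (simp add: language_def language_axioms_def op_cat_full_subcat)

lemma op_extends_L: "language.extends_L (op_cat I) (op_cat C) S L A \<longleftrightarrow> extends_L A"
  unfolding language.extends_L_def[OF language_op_cat] extends_L_def op_cat_functor_iff by auto

lemma op_strict_left_extension:
  "language.strict_left_extension (op_cat I) (op_cat C) S L R \<longleftrightarrow> strict_right_extension R"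
  unfolding language.strict_left_extension_def[OF language_op_cat] strict_right_extension_def
    op_extends_L op_cat_functor_iff op_cat_full_subcat[symmetric] natural_family_op_cat by simp

lemma op_strict_right_extension:
  "language.strict_right_extension (op_cat I) (op_cat C) S L R \<longleftrightarrow> strict_left_extension R"
  unfolding language.strict_right_extension_def[OF language_op_cat] strict_left_extension_def
    op_extends_L op_cat_functor_iff op_cat_full_subcat[symmetric] natural_family_op_cat by simp

lemma cocomplete_strict_left_extension:
  assumes "infinite U" "small_cat U I" "cocomplete_cat U C"
  shows "\<exists>R. strict_left_extension R"
  using language.complete_strict_right_extension[OF language_op_cat assms(1)]
    small_cat_op_cat[OF assms(2)] complete_cat_op_cat[OF assms(3)]
  unfolding op_strict_right_extension by blast

section \<open>Kan extensions restricting to \<open>L\<close>, with an arbitrary unit or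
  counit\<close>

definition left_kan_family :: "('io, 'ia, 'co, 'ca) func \<Rightarrow> ('io \<Rightarrow> 'ca) \<Rightarrow> bool" where
  "left_kan_family R \<eta> \<longleftrightarrow> extends_L R \<and> natural_family (full_subcat I S) C L L \<eta> \<and>
     (\<forall>G \<gamma>. cat_functor I C G \<longrightarrow> natural_family (full_subcat I S) C L G \<gamma> \<longrightarrow>
        (\<exists>!\<delta>. natural_family I C R G \<delta> \<and> (\<forall>x \<in> S. Comp C (\<delta> x) (\<eta> x) = \<gamma> x)))"

definition right_kan_family :: "('io, 'ia, 'co, 'ca) func \<Rightarrow> ('io \<Rightarrow> 'ca) \<Rightarrow> bool" where
  "right_kan_family R \<epsilon> \<longleftrightarrow> extends_L R \<and> natural_family (full_subcat I S) C L L \<epsilon> \<and>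
     (\<forall>G \<gamma>. cat_functor I C G \<longrightarrow> natural_family (full_subcat I S) C G L \<gamma> \<longrightarrow>
        (\<exists>!\<delta>. natural_family I C G R \<delta> \<and> (\<forall>x \<in> S. Comp C (\<epsilon> x) (\<delta> x) = \<gamma> x)))"

lemma extends_L_functor: "extends_L A \<Longrightarrow> cat_functor I C A"
  by (simp add: extends_L_def)

lemma extends_L_FOb: "extends_L A \<Longrightarrow> x \<in> S \<Longrightarrow> FOb A x = FOb L x"
  by (simp add: extends_L_def)

lemma extends_L_FAr: "extends_L A \<Longrightarrow> f \<in> Ar I \<Longrightarrow> Dom I f \<in> S \<Longrightarrow> Cod I f \<in> S \<Longrightarrow> FAr A f = FAr L f"
  by (simp add: extends_L_def)

lemmas extends_L_simps = extends_L_FOb extends_L_FAr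

lemma category_O: "category (full_subcat I S)"
  by (rule L.A.category_axioms)

lemma natural_family_extends_L:
  assumes "extends_L A"
  shows "natural_family (full_subcat I S) C A F t \<longleftrightarrow> natural_family (full_subcat I S) C L F t"
    and "natural_family (full_subcat I S) C F A t \<longleftrightarrow> natural_family (full_subcat I S) C F L t"
  by (rule natural_family_cong[OF category_O]; use assms in \<open>auto simp: extends_L_simps\<close>)+

lemma fcomp_inclusion:
  "fcomp (full_subcat I S) A (inclusion (full_subcat I S)) =
    \<lparr>FOb = restrict (FOb A) S, FAr = restrict (FAr A) (Ar (full_subcat I S))\<rparr>"
  by (auto simp: fcomp_def inclusion_def compose_def fun_eq_iff)

lemma cat_functor_fcomp_inclusion:
  assumes "cat_functor I C A"
  shows "cat_functor (full_subcat I S) C (fcomp (full_subcat I S) A (inclusion (full_subcat I S)))"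
proof -
  interpret A: cat_functor I C A by fact
  show ?thesis
    unfolding fcomp_inclusion
    by (rule cat_functor_arrowI[OF category_O C.category_axioms])
      (auto simp: Hom_def A.FAr_Ide A.FAr_Comp_arrow)
qed

lemma natural_family_fcomp_inclusion:
  "natural_family (full_subcat I S) C F (fcomp (full_subcat I S) G (inclusion (full_subcat I S))) \<gamma>
    \<longleftrightarrow> natural_family (full_subcat I S) C F G \<gamma>"
  "natural_family (full_subcat I S) C (fcomp (full_subcat I S) G (inclusion (full_subcat I S))) F \<gamma>
    \<longleftrightarrow> natural_family (full_subcat I S) C G F \<gamma>"
  by (rule natural_family_cong[OF category_O]; simp add: fcomp_inclusion)+

text \<open>Comparing with a strict extension \<open>R'\<close> shows that the unit of a Kan extension restricting
  strictly to \<open>L\<close> is invertible, so that it may be replaced by the identity.\<close>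

lemma strict_left_extension_if_left_kan_family:
  assumes R: "left_kan_family R \<eta>" and R': "strict_left_extension R'"
  shows "strict_left_extension R"
proof -
  let ?O = "full_subcat I S"
  have ext: "extends_L R" "extends_L R'" and \<eta>: "natural_family ?O C L L \<eta>"
    using R R' by (auto simp: left_kan_family_def strict_left_extension_def)
  have fnc: "cat_functor I C R" "cat_functor I C R'"
    using ext by (auto simp: extends_L_functor)
  interpret R: cat_functor I C R by fact
  have \<eta>_arrow [simp]: "\<eta> x \<in> Ar C" "Dom C (\<eta> x) = FOb L x" "Cod C (\<eta> x) = FOb L x" if "x \<in> S" for x
    using natural_family_arrow[OF \<eta>] that by auto
  have "natural_family ?O C L R' (\<lambda>x \<in> S. Ide C (FOb L x))"
    using natural_family_Ide[OF L_functor] ext by (simp add: natural_family_extends_L)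
  \<comment> \<open>The universal property of \<open>R\<close>, applied to the identity of
    \<open>L\<close>, makes \<open>s\<close> a left inverse of the unit on \<open>S\<close>.\<close>
  then obtain s where s: "natural_family I C R R' s"
    and s\<eta>: "\<And>x. x \<in> S \<Longrightarrow> Comp C (s x) (\<eta> x) = Ide C (FOb L x)"
    using R fnc(2) unfolding left_kan_family_def by (smt (verit) restrict_apply')
  have "natural_family ?O C L R \<eta>"
    using \<eta> ext by (simp add: natural_family_extends_L)
  \<comment> \<open>The universal property of \<open>R'\<close> extends the unit itself to a
    transformation back to \<open>R\<close>.\<close>
  then obtain t where t: "natural_family I C R' R t" and t\<eta>: "\<And>x. x \<in> S \<Longrightarrow> t x = \<eta> x"
    using R' fnc(1) unfolding strict_left_extension_def by blast
  have s_arrow [simp]: "s x \<in> Ar C" "Dom C (s x) = FOb L x" "Cod C (s x) = FOb L x" if "x \<in> S" for x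
    using natural_family_arrow[OF s, of x] that ext by (auto simp: extends_L_simps)
  let ?ts = "\<lambda>x \<in> Ob I. Comp C (t x) (s x)" and ?id = "\<lambda>x \<in> Ob I. Ide C (FOb R x)"
  have "natural_family I C R R ?ts" "natural_family I C R R ?id"
    using natural_family_Comp[OF fnc fnc(1) s t] natural_family_Ide[OF fnc(1)] by auto
  moreover have "\<forall>x \<in> S. Comp C (?ts x) (\<eta> x) = \<eta> x" "\<forall>x \<in> S. Comp C (?id x) (\<eta> x) = \<eta> x"
    using ext by (auto simp: t\<eta> s\<eta> C.Comp_assoc_arrow extends_L_simps)
  \<comment> \<open>Both endomorphisms of \<open>R\<close> factor the unit through itself, so they
    coincide; read on \<open>S\<close>, this says that \<open>s\<close> is a right inverse of the
    unit as well.\<close>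
  ultimately have "?ts = ?id"
    using R fnc(1) \<open>natural_family ?O C L R \<eta>\<close> unfolding left_kan_family_def by blast
  then have \<eta>s: "Comp C (\<eta> x) (s x) = Ide C (FOb L x)" if "x \<in> S" for x
    using that t\<eta> ext by (auto dest!: fun_cong[of _ _ x] simp: extends_L_simps)
  have "\<exists>!\<delta>. natural_family I C R G \<delta> \<and> (\<forall>x \<in> S. \<delta> x = \<gamma> x)"
    if G: "cat_functor I C G" and \<gamma>: "natural_family ?O C L G \<gamma>" for G \<gamma>
  proof -
    have "natural_family ?O C L (fcomp ?O G (inclusion ?O)) (\<lambda>x \<in> Ob ?O. Comp C (\<gamma> x) (\<eta> x))"
      by (rule natural_family_Comp[OF L_functor L_functor cat_functor_fcomp_inclusion[OF G] \<eta>])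
        (use \<gamma> in \<open>simp add: natural_family_fcomp_inclusion\<close>)
    then have \<gamma>\<eta>: "natural_family ?O C L G (\<lambda>x \<in> S. Comp C (\<gamma> x) (\<eta> x))"
      by (simp add: natural_family_fcomp_inclusion)
    \<comment> \<open>The unit can be cancelled on the right, so factoring \<open>\<gamma>\<close>
      composed with the unit through the unit amounts to extending \<open>\<gamma>\<close>.\<close>
    have "(\<forall>x \<in> S. Comp C (\<delta> x) (\<eta> x) = (\<lambda>x \<in> S. Comp C (\<gamma> x) (\<eta> x)) x) \<longleftrightarrow> (\<forall>x \<in> S. \<delta> x = \<gamma> x)"
      if \<delta>: "natural_family I C R G \<delta>" for \<delta>
    proof -
      have "\<delta> x = \<gamma> x" if x: "x \<in> S" and eq: "Comp C (\<delta> x) (\<eta> x) = Comp C (\<gamma> x) (\<eta> x)" for x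
      proof -
        have "Comp C (Comp C (\<delta> x) (\<eta> x)) (s x) = Comp C (Comp C (\<gamma> x) (\<eta> x)) (s x)"
          using eq by simp
        then show ?thesis
          using x natural_family_arrow[OF \<delta>, of x] natural_family_arrow[OF \<gamma>, of x] ext(1)
          by (simp add: C.Comp_assoc_arrow \<eta>s extends_L_simps)
      qed
      then show ?thesis by auto
    qed
    moreover have "\<exists>!\<delta>. natural_family I C R G \<delta> \<and>
        (\<forall>x \<in> S. Comp C (\<delta> x) (\<eta> x) = (\<lambda>x \<in> S. Comp C (\<gamma> x) (\<eta> x)) x)"
      using R G \<gamma>\<eta> unfolding left_kan_family_def by blast
    ultimately show ?thesis
      by (simp cong: conj_cong)
  qed
  then show ?thesis
    using ext by (simp add: strict_left_extension_def)
qed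

lemma left_kan_family_if_strict_left_extension:
  assumes R: "strict_left_extension R"
  shows "left_kan_family R (\<lambda>x \<in> S. Ide C (FOb L x))"
proof -
  have ext: "extends_L R"
    using R by (simp add: strict_left_extension_def)
  have "(\<forall>x \<in> S. Comp C (\<delta> x) ((\<lambda>x \<in> S. Ide C (FOb L x)) x) = \<gamma> x) \<longleftrightarrow> (\<forall>x \<in> S. \<delta> x = \<gamma> x)"
    if "natural_family I C R G \<delta>" for G \<delta> \<gamma>
    using natural_family_arrow[OF that] ext by (simp add: extends_L_simps)
  with R ext show ?thesis
    using natural_family_Ide[OF L_functor]
    by (simp add: left_kan_family_def strict_left_extension_def cong: conj_cong)
qed

lemma op_left_kan_family:
  "language.left_kan_family (op_cat I) (op_cat C) S L R \<eta> \<longleftrightarrow> right_kan_family R \<eta>"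
  unfolding language.left_kan_family_def[OF language_op_cat] right_kan_family_def
    op_extends_L op_cat_functor_iff op_cat_full_subcat[symmetric] natural_family_op_cat by simp

lemma strict_right_extension_if_right_kan_family:
  "right_kan_family R \<epsilon> \<Longrightarrow> strict_right_extension R' \<Longrightarrow> strict_right_extension R"
  using language.strict_left_extension_if_left_kan_family[OF language_op_cat]
  unfolding op_left_kan_family op_strict_left_extension by blast

lemma right_kan_family_if_strict_right_extension:
  "strict_right_extension R \<Longrightarrow> right_kan_family R (\<lambda>x \<in> S. Ide C (FOb L x))"
  using language.left_kan_family_if_strict_left_extension[OF language_op_cat]
  unfolding op_left_kan_family op_strict_left_extension by simp

section \<open>The category of automata and its initial and final objects\<close>

abbreviation aut :: "(('io, 'ia, 'co, 'ca) func, ('io, 'ia, 'co, 'ca) ntrans) cat" where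
  "aut \<equiv> Auto (full_subcat I S) I (inclusion (full_subcat I S)) C L"

text \<open>Agreement on \<open>S\<close> becomes an equality of functors because \<open>L\<close>
  is undefined outside the subcategory, just as the composite is.\<close>

lemma fcomp_inclusion_eq_L:
  assumes "cat_functor I C A"
  shows "fcomp (full_subcat I S) A (inclusion (full_subcat I S)) = L \<longleftrightarrow> extends_L A"
proof
  assume "extends_L A"
  have "restrict (FOb A) S = FOb L"
    using L.FOb_in \<open>extends_L A\<close> by (intro extensionalityI[of _ S]) (auto simp: extends_L_simps PiE_def)
  moreover have "restrict (FAr A) (Ar (full_subcat I S)) = FAr L"
    using L.FAr_extensional \<open>extends_L A\<close>
    by (intro extensionalityI[of _ "Ar (full_subcat I S)"]) (auto simp: extends_L_simps)
  ultimately show "fcomp (full_subcat I S) A (inclusion (full_subcat I S)) = L"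
    by (simp add: fcomp_inclusion)
next
  assume eq: "fcomp (full_subcat I S) A (inclusion (full_subcat I S)) = L"
  have "FOb L = restrict (FOb A) S" "FAr L = restrict (FAr A) (Ar (full_subcat I S))"
    unfolding eq[symmetric] fcomp_inclusion by simp_all
  then show "extends_L A"
    using assms by (simp add: extends_L_def)
qed

lemma Ob_aut: "A \<in> Ob aut \<longleftrightarrow> extends_L A"
  using fcomp_inclusion_eq_L extends_L_functor by (auto simp: Auto_def functor_cat_def)

text \<open>A transformation records its ends, so being sent by whiskering to the identity of
  \<open>L\<close> already forces both ends to accept \<open>L\<close>; what remains is a condition
  on the components over \<open>S\<close>.\<close>

lemma Ar_aut: "\<alpha> \<in> Ar aut \<longleftrightarrow> extends_L (NDom \<alpha>) \<and> extends_L (NCod \<alpha>) \<and>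
    natural_family I C (NDom \<alpha>) (NCod \<alpha>) (NComp \<alpha>) \<and> (\<forall>x \<in> S. NComp \<alpha> x = Ide C (FOb L x))"
proof -
  have "compose S (NComp \<alpha>) (\<lambda>x \<in> S. x) = (\<lambda>x \<in> S. Ide C (FOb L x)) \<longleftrightarrow>
      (\<forall>x \<in> S. NComp \<alpha> x = Ide C (FOb L x))"
    by (auto simp: compose_def fun_eq_iff)
  moreover have "nat_trans I C \<alpha> \<longleftrightarrow> cat_functor I C (NDom \<alpha>) \<and> cat_functor I C (NCod \<alpha>) \<and>
      natural_family I C (NDom \<alpha>) (NCod \<alpha>) (NComp \<alpha>)"
    using Hom_functor_cat[of \<alpha> I C "NDom \<alpha>" "NCod \<alpha>"] by (simp add: Hom_def functor_cat_def)
  ultimately show ?thesis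
    using fcomp_inclusion_eq_L extends_L_functor
    by (auto simp: Auto_def functor_cat_def whisker_def inclusion_def)
qed

lemma aut_simps [simp]:
  "Dom aut = NDom" "Cod aut = NCod"
  "Ide aut F = \<lparr>NDom = F, NCod = F, NComp = (\<lambda>x \<in> Ob I. Ide C (FOb F x))\<rparr>"
  "Comp aut \<beta> \<alpha> = \<lparr>NDom = NDom \<alpha>, NCod = NCod \<beta>,
    NComp = (\<lambda>x \<in> Ob I. Comp C (NComp \<beta> x) (NComp \<alpha> x))\<rparr>"
  by (simp_all add: Auto_def functor_cat_def)

lemma Hom_aut: "\<alpha> \<in> Hom aut F G \<longleftrightarrow> NDom \<alpha> = F \<and> NCod \<alpha> = G \<and> extends_L F \<and> extends_L G \<and>
    natural_family I C F G (NComp \<alpha>) \<and> (\<forall>x \<in> S. NComp \<alpha> x = Ide C (FOb L x))"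
  by (auto simp: Hom_def Ar_aut)

lemma Ar_aut_component:
  assumes "\<alpha> \<in> Ar aut" "x \<in> Ob I"
  shows "NComp \<alpha> x \<in> Ar C" "Dom C (NComp \<alpha> x) = FOb (NDom \<alpha>) x"
    "Cod C (NComp \<alpha> x) = FOb (NCod \<alpha>) x"
  using assms natural_family_arrow by (auto simp: Ar_aut)

lemma ntrans_eqI:
  assumes "\<alpha> \<in> Ar aut" "\<beta> \<in> Ar aut" "NDom \<alpha> = NDom \<beta>" "NCod \<alpha> = NCod \<beta>"
    and "\<And>x. x \<in> Ob I \<Longrightarrow> NComp \<alpha> x = NComp \<beta> x"
  shows "\<alpha> = \<beta>"
proof -
  have "NComp \<alpha> = NComp \<beta>"
    using assms natural_family_eqI by (fastforce simp: Ar_aut)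
  then show ?thesis
    using assms by simp
qed

lemma extends_L_Ob [simp]: "extends_L A \<Longrightarrow> x \<in> Ob I \<Longrightarrow> FOb A x \<in> Ob C"
  by (meson cat_functor.FOb_Ob extends_L_functor)

lemma extends_L_Ar [simp]:
  assumes "extends_L A" "f \<in> Ar I"
  shows "FAr A f \<in> Ar C" "Dom C (FAr A f) = FOb A (Dom I f)" "Cod C (FAr A f) = FOb A (Cod I f)"
  using cat_functor.FAr_arrow[OF extends_L_functor] assms by auto

lemma Ide_aut_Ar: "extends_L A \<Longrightarrow> Ide aut A \<in> Ar aut"
  using natural_family_Ide[OF extends_L_functor] by (simp add: Ar_aut extends_L_FOb)

lemma Comp_aut_Ar:
  assumes "\<alpha> \<in> Ar aut" "\<beta> \<in> Ar aut" "NDom \<beta> = NCod \<alpha>"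
  shows "Comp aut \<beta> \<alpha> \<in> Ar aut"
  using assms natural_family_Comp[of I C "NDom \<alpha>" "NCod \<alpha>" "NCod \<beta>" "NComp \<alpha>" "NComp \<beta>"]
  by (auto simp: Ar_aut extends_L_functor)

lemma category_aut: "category aut"
proof (rule category_arrowI)
  fix \<alpha> \<beta> \<gamma>
  assume "\<alpha> \<in> Ar aut" "\<beta> \<in> Ar aut" "\<gamma> \<in> Ar aut" "Dom aut \<beta> = Cod aut \<alpha>" "Dom aut \<gamma> = Cod aut \<beta>"
  then show "Comp aut \<gamma> (Comp aut \<beta> \<alpha>) = Comp aut (Comp aut \<gamma> \<beta>) \<alpha>"
    by (auto simp: Ar_aut_component C.Comp_assoc_arrow fun_eq_iff)
next
  fix \<alpha> assume \<alpha>: "\<alpha> \<in> Ar aut"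
  then have ext: "extends_L (NDom \<alpha>)" "extends_L (NCod \<alpha>)"
    by (auto simp: Ar_aut)
  show "Comp aut \<alpha> (Ide aut (Dom aut \<alpha>)) = \<alpha> \<and> Comp aut (Ide aut (Cod aut \<alpha>)) \<alpha> = \<alpha>"
  proof
    show "Comp aut \<alpha> (Ide aut (Dom aut \<alpha>)) = \<alpha>"
      by (rule ntrans_eqI[OF Comp_aut_Ar[OF Ide_aut_Ar]])
        (use \<alpha> ext in \<open>auto simp: Ar_aut_component\<close>)
    show "Comp aut (Ide aut (Cod aut \<alpha>)) \<alpha> = \<alpha>"
      by (rule ntrans_eqI[OF Comp_aut_Ar[OF _ Ide_aut_Ar]])
        (use \<alpha> ext in \<open>auto simp: Ar_aut_component\<close>)
  qed
qed (use Ide_aut_Ar Comp_aut_Ar in \<open>auto simp: Ob_aut Ar_aut\<close>)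

lemma Ex1_Hom_aut:
  assumes "extends_L F" "extends_L G"
  shows "(\<exists>!\<delta>. \<delta> \<in> Hom aut F G) \<longleftrightarrow>
    (\<exists>!t. natural_family I C F G t \<and> (\<forall>x \<in> S. t x = Ide C (FOb L x)))"
proof -
  have "bij_betw NComp (Hom aut F G)
      {t. natural_family I C F G t \<and> (\<forall>x \<in> S. t x = Ide C (FOb L x))}"
    by (rule bij_betw_byWitness[where f' = "\<lambda>t. \<lparr>NDom = F, NCod = G, NComp = t\<rparr>"])
      (use assms in \<open>auto simp: Hom_aut\<close>)
  from bij_betw_Ex1_iff[OF this] show ?thesis by simp
qed

text \<open>An arrow of automata is a transformation that is the identity over \<open>S\<close>, so
  those from \<open>R\<close> to \<open>B\<close> are the extensions of the identity of
  \<open>L\<close>, viewed as a transformation into the restriction of \<open>B\<close>.\<close>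

lemma initial_strict_left_extension:
  assumes "strict_left_extension R"
  shows "initial aut R"
  unfolding initial_def Ob_aut
proof (intro conjI ballI)
  show R: "extends_L R"
    using assms by (simp add: strict_left_extension_def)
  fix B assume B: "B \<in> Ob aut"
  then have "natural_family (full_subcat I S) C L B (\<lambda>x \<in> S. Ide C (FOb L x))"
    using natural_family_Ide[OF L_functor] by (simp add: natural_family_extends_L Ob_aut)
  moreover have "cat_functor I C B"
    using B by (simp add: Ob_aut extends_L_functor)
  ultimately have "\<exists>!t. natural_family I C R B t \<and>
      (\<forall>x \<in> S. t x = (\<lambda>x \<in> S. Ide C (FOb L x)) x)"
    using assms unfolding strict_left_extension_def by blast
  then show "\<exists>!f. f \<in> Hom aut R B"
    using R B by (simp add: Ex1_Hom_aut Ob_aut)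
qed

lemma final_strict_right_extension:
  assumes "strict_right_extension R"
  shows "final aut R"
  unfolding final_def Ob_aut
proof (intro conjI ballI)
  show R: "extends_L R"
    using assms by (simp add: strict_right_extension_def)
  fix B assume B: "B \<in> Ob aut"
  then have "natural_family (full_subcat I S) C B L (\<lambda>x \<in> S. Ide C (FOb L x))"
    using natural_family_Ide[OF L_functor] by (simp add: natural_family_extends_L Ob_aut)
  moreover have "cat_functor I C B"
    using B by (simp add: Ob_aut extends_L_functor)
  ultimately have "\<exists>!t. natural_family I C B R t \<and>
      (\<forall>x \<in> S. t x = (\<lambda>x \<in> S. Ide C (FOb L x)) x)"
    using assms unfolding strict_right_extension_def by blast
  then show "\<exists>!f. f \<in> Hom aut B R"
    using R B by (simp add: Ex1_Hom_aut Ob_aut)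
qed

text \<open>As \<open>R\<close> restricts to \<open>L\<close> exactly, a unit is an endomorphism of
  \<open>L\<close> in the functor category, and only its components matter. If \<open>\<eta>\<close>
  is not such an endomorphism, both sides fail.\<close>

lemma left_kan_iff:
  assumes R: "extends_L R"
  shows "left_kan (full_subcat I S) I C (inclusion (full_subcat I S)) L R \<eta> \<longleftrightarrow>
    NDom \<eta> = L \<and> NCod \<eta> = L \<and> left_kan_family R (NComp \<eta>)"
proof -
  let ?O = "full_subcat I S" and ?\<iota> = "inclusion (full_subcat I S)"
  have RL: "fcomp ?O R ?\<iota> = L"
    using R fcomp_inclusion_eq_L extends_L_functor by blast
  have Ob: "G \<in> Ob (functor_cat I C) \<longleftrightarrow> cat_functor I C G" for G
    by (simp add: functor_cat_def)
  have eq: "(\<exists>!\<delta>. \<delta> \<in> Hom (functor_cat I C) R G \<and>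
        Comp (functor_cat ?O C) (whisker ?O \<delta> ?\<iota>) \<eta> = \<gamma>) \<longleftrightarrow>
      (\<exists>!t. natural_family I C R G t \<and> (\<forall>x \<in> S. Comp C (t x) (NComp \<eta> x) = NComp \<gamma> x))"
    if \<eta>: "\<eta> \<in> Hom (functor_cat ?O C) L L" and G: "cat_functor I C G"
      and \<gamma>: "\<gamma> \<in> Hom (functor_cat ?O C) L (fcomp ?O G ?\<iota>)" for G \<gamma>
  proof -
    \<comment> \<open>These facts reduce the equality of two transformations to equations on
      \<open>S\<close>: the recorded ends agree, and both component maps are undefined outside
      \<open>S\<close>.\<close>
    have *: "NComp \<gamma> \<in> extensional S" "NDom \<gamma> = L" "NCod \<gamma> = fcomp ?O G ?\<iota>" "NDom \<eta> = L"
      using \<gamma> \<eta> by (auto simp: Hom_functor_cat natural_family_def PiE_def)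
    have "Comp (functor_cat ?O C) (whisker ?O \<delta> ?\<iota>) \<eta> = \<gamma> \<longleftrightarrow>
        (\<forall>x \<in> S. Comp C (NComp \<delta> x) (NComp \<eta> x) = NComp \<gamma> x)"
      if "\<delta> \<in> Hom (functor_cat I C) R G" for \<delta>
    proof -
      have "NDom \<delta> = R" "NCod \<delta> = G"
        using that by (auto simp: Hom_functor_cat)
      with * show ?thesis
        by (cases \<gamma>) (auto simp: functor_cat_def whisker_def inclusion_def compose_def fun_eq_iff
          extensional_def)
    qed
    then show ?thesis
      using Ex1_Hom_functor_cat[OF extends_L_functor[OF R] G] by (simp cong: conj_cong)
  qed
  show ?thesis
  proof (cases "\<eta> \<in> Hom (functor_cat ?O C) L L")
    case True
    have "left_kan ?O I C ?\<iota> L R \<eta> \<longleftrightarrow>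
      (\<forall>G. cat_functor I C G \<longrightarrow> (\<forall>\<gamma> \<in> Hom (functor_cat ?O C) L (fcomp ?O G ?\<iota>).
        \<exists>!t. natural_family I C R G t \<and> (\<forall>x \<in> S. Comp C (t x) (NComp \<eta> x) = NComp \<gamma> x)))"
      by (simp add: left_kan_def Ob RL True extends_L_functor[OF R] eq[OF True] Ball_def
        cong: imp_cong)
    also have "\<dots> \<longleftrightarrow> (\<forall>G \<gamma>. cat_functor I C G \<longrightarrow> natural_family ?O C L G \<gamma> \<longrightarrow>
        (\<exists>!t. natural_family I C R G t \<and> (\<forall>x \<in> S. Comp C (t x) (NComp \<eta> x) = \<gamma> x)))"
    proof (intro iffI allI impI ballI)
      fix G \<gamma>
      assume *: "\<forall>G. cat_functor I C G \<longrightarrow> (\<forall>\<gamma> \<in> Hom (functor_cat ?O C) L (fcomp ?O G ?\<iota>).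
        \<exists>!t. natural_family I C R G t \<and> (\<forall>x \<in> S. Comp C (t x) (NComp \<eta> x) = NComp \<gamma> x))"
        and G: "cat_functor I C G" and \<gamma>: "natural_family ?O C L G \<gamma>"
      have "\<lparr>NDom = L, NCod = fcomp ?O G ?\<iota>, NComp = \<gamma>\<rparr> \<in> Hom (functor_cat ?O C) L (fcomp ?O G ?\<iota>)"
        using \<gamma> G L_functor
        by (simp add: Hom_functor_cat cat_functor_fcomp_inclusion natural_family_fcomp_inclusion)
      from *[rule_format, OF G this]
      show "\<exists>!t. natural_family I C R G t \<and> (\<forall>x \<in> S. Comp C (t x) (NComp \<eta> x) = \<gamma> x)"
        by simp
    qed (auto simp: Hom_functor_cat natural_family_fcomp_inclusion)
    finally show ?thesis
      using True R unfolding left_kan_family_def Hom_functor_cat by simp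
  next
    case False
    then show ?thesis
      using RL L_functor by (auto simp: left_kan_def left_kan_family_def Hom_functor_cat)
  qed
qed

text \<open>The argument of \<open>left_kan_iff\<close> with composition reversed. It is not read
  off by duality, since passing to opposites swaps the ends stored in a transformation.\<close>

lemma right_kan_iff:
  assumes R: "extends_L R"
  shows "right_kan (full_subcat I S) I C (inclusion (full_subcat I S)) L R \<epsilon> \<longleftrightarrow>
    NDom \<epsilon> = L \<and> NCod \<epsilon> = L \<and> right_kan_family R (NComp \<epsilon>)"
proof -
  let ?O = "full_subcat I S" and ?\<iota> = "inclusion (full_subcat I S)"
  have RL: "fcomp ?O R ?\<iota> = L"
    using R fcomp_inclusion_eq_L extends_L_functor by blast
  have Ob: "G \<in> Ob (functor_cat I C) \<longleftrightarrow> cat_functor I C G" for G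
    by (simp add: functor_cat_def)
  have eq: "(\<exists>!\<delta>. \<delta> \<in> Hom (functor_cat I C) G R \<and>
        Comp (functor_cat ?O C) \<epsilon> (whisker ?O \<delta> ?\<iota>) = \<gamma>) \<longleftrightarrow>
      (\<exists>!t. natural_family I C G R t \<and> (\<forall>x \<in> S. Comp C (NComp \<epsilon> x) (t x) = NComp \<gamma> x))"
    if \<epsilon>: "\<epsilon> \<in> Hom (functor_cat ?O C) L L" and G: "cat_functor I C G"
      and \<gamma>: "\<gamma> \<in> Hom (functor_cat ?O C) (fcomp ?O G ?\<iota>) L" for G \<gamma>
  proof -
    have *: "NComp \<gamma> \<in> extensional S" "NCod \<gamma> = L" "NDom \<gamma> = fcomp ?O G ?\<iota>" "NCod \<epsilon> = L"
      using \<gamma> \<epsilon> by (auto simp: Hom_functor_cat natural_family_def PiE_def)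
    have "Comp (functor_cat ?O C) \<epsilon> (whisker ?O \<delta> ?\<iota>) = \<gamma> \<longleftrightarrow>
        (\<forall>x \<in> S. Comp C (NComp \<epsilon> x) (NComp \<delta> x) = NComp \<gamma> x)"
      if "\<delta> \<in> Hom (functor_cat I C) G R" for \<delta>
    proof -
      have "NDom \<delta> = G" "NCod \<delta> = R"
        using that by (auto simp: Hom_functor_cat)
      with * show ?thesis
        by (cases \<gamma>) (auto simp: functor_cat_def whisker_def inclusion_def compose_def fun_eq_iff
          extensional_def)
    qed
    then show ?thesis
      using Ex1_Hom_functor_cat[OF G extends_L_functor[OF R]] by (simp cong: conj_cong)
  qed
  show ?thesis
  proof (cases "\<epsilon> \<in> Hom (functor_cat ?O C) L L")
    case True
    have "right_kan ?O I C ?\<iota> L R \<epsilon> \<longleftrightarrow>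
      (\<forall>G. cat_functor I C G \<longrightarrow> (\<forall>\<gamma> \<in> Hom (functor_cat ?O C) (fcomp ?O G ?\<iota>) L.
        \<exists>!t. natural_family I C G R t \<and> (\<forall>x \<in> S. Comp C (NComp \<epsilon> x) (t x) = NComp \<gamma> x)))"
      by (simp add: right_kan_def Ob RL True extends_L_functor[OF R] eq[OF True] Ball_def
        cong: imp_cong)
    also have "\<dots> \<longleftrightarrow> (\<forall>G \<gamma>. cat_functor I C G \<longrightarrow> natural_family ?O C G L \<gamma> \<longrightarrow>
        (\<exists>!t. natural_family I C G R t \<and> (\<forall>x \<in> S. Comp C (NComp \<epsilon> x) (t x) = \<gamma> x)))"
    proof (intro iffI allI impI ballI)
      fix G \<gamma>
      assume *: "\<forall>G. cat_functor I C G \<longrightarrow> (\<forall>\<gamma> \<in> Hom (functor_cat ?O C) (fcomp ?O G ?\<iota>) L.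
        \<exists>!t. natural_family I C G R t \<and> (\<forall>x \<in> S. Comp C (NComp \<epsilon> x) (t x) = NComp \<gamma> x))"
        and G: "cat_functor I C G" and \<gamma>: "natural_family ?O C G L \<gamma>"
      have "\<lparr>NDom = fcomp ?O G ?\<iota>, NCod = L, NComp = \<gamma>\<rparr> \<in> Hom (functor_cat ?O C) (fcomp ?O G ?\<iota>) L"
        using \<gamma> G L_functor
        by (simp add: Hom_functor_cat cat_functor_fcomp_inclusion natural_family_fcomp_inclusion)
      from *[rule_format, OF G this]
      show "\<exists>!t. natural_family I C G R t \<and> (\<forall>x \<in> S. Comp C (NComp \<epsilon> x) (t x) = \<gamma> x)"
        by simp
    qed (auto simp: Hom_functor_cat natural_family_fcomp_inclusion)
    finally show ?thesis
      using True R unfolding right_kan_family_def Hom_functor_cat by simp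
  next
    case False
    then show ?thesis
      using RL L_functor by (auto simp: right_kan_def right_kan_family_def Hom_functor_cat)
  qed
qed

lemma strict_left_extension_left_kan:
  assumes "strict_left_extension R"
  shows "left_kan (full_subcat I S) I C (inclusion (full_subcat I S)) L R
    (Ide (functor_cat (full_subcat I S) C) L)"
  using assms left_kan_family_if_strict_left_extension[OF assms]
  by (subst left_kan_iff) (auto simp: strict_left_extension_def functor_cat_def)

lemma strict_right_extension_right_kan:
  assumes "strict_right_extension R"
  shows "right_kan (full_subcat I S) I C (inclusion (full_subcat I S)) L R
    (Ide (functor_cat (full_subcat I S) C) L)"
  using assms right_kan_family_if_strict_right_extension[OF assms]
  by (subst right_kan_iff) (auto simp: strict_right_extension_def functor_cat_def)

end

section \<open>Factorization systems and minimality\<close>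

context factorization_system
begin

text \<open>Both arrows fill the square with sides \<open>Comp C d e\<close> and
  \<open>Comp C m d\<close>, which commutes by associativity. Equations between diagonal fillers are
  checked by this principle.\<close>

lemma diagonal_unique:
  assumes "e \<in> E" "m \<in> M" "d \<in> Ar C" "d' \<in> Ar C"
    and "Dom C d = Cod C e" "Dom C d' = Cod C e" "Cod C d = Dom C m" "Cod C d' = Dom C m"
    and "Comp C d e = Comp C d' e" "Comp C m d = Comp C m d'"
  shows "d = d'"
proof -
  have "e \<in> Ar C" "m \<in> Ar C"
    using assms E_arrows M_arrows by auto
  then have "\<exists>!k. k \<in> Hom C (Cod C e) (Dom C m) \<and> Comp C k e = Comp C d e \<and> Comp C m k = Comp C m d"
    using assms by (intro orthogonality) (auto simp: Hom_def Comp_assoc_arrow)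
  moreover have "d \<in> Hom C (Cod C e) (Dom C m)" "d' \<in> Hom C (Cod C e) (Dom C m)"
    using assms by (auto simp: Hom_def)
  ultimately show ?thesis
    using assms by metis
qed

text \<open>Each factorization is compared with the other by a diagonal filler. The two composites
  of the fillers, like the identities, fill the square of a factorization against itself.\<close>

lemma factorization_iso:
  assumes f: "is_factorization C E M f e z m" and f': "is_factorization C E M f e' z' m'"
  obtains k where "k \<in> Hom C z z'" "iso_arrow C k"
proof -
  have em: "e \<in> E" "m \<in> M" "e' \<in> E" "m' \<in> M"
    and [simp]: "e \<in> Ar C" "m \<in> Ar C" "e' \<in> Ar C" "m' \<in> Ar C"
    and dc [simp]: "Dom C e = Dom C f" "Cod C e = z" "Dom C m = z" "Cod C m = Cod C f"
      "Dom C e' = Dom C f" "Cod C e' = z'" "Dom C m' = z'" "Cod C m' = Cod C f"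
    using f f' unfolding is_factorization_def Hom_def by blast+
  have eq: "Comp C m' e' = Comp C m e"
    using f f' unfolding is_factorization_def by metis
  have z [simp]: "z \<in> Ob C" "z' \<in> Ob C"
    using Cod_in_Ob[of e] Cod_in_Ob[of e'] by simp_all
  have "\<exists>!k. k \<in> Hom C (Cod C e) (Dom C m') \<and> Comp C k e = e' \<and> Comp C m' k = m"
    by (rule orthogonality[OF em(1,4)]) (simp_all add: Hom_def eq)
  then obtain k where k: "k \<in> Hom C z z'" "Comp C k e = e'" "Comp C m' k = m"
    unfolding dc by blast
  have "\<exists>!l. l \<in> Hom C (Cod C e') (Dom C m) \<and> Comp C l e' = e \<and> Comp C m l = m'"
    by (rule orthogonality[OF em(3,2)]) (simp_all add: Hom_def eq)
  then obtain l where l: "l \<in> Hom C z' z" "Comp C l e' = e" "Comp C m l = m'"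
    unfolding dc by blast
  have [simp]: "k \<in> Ar C" "Dom C k = z" "Cod C k = z'" "l \<in> Ar C" "Dom C l = z'" "Cod C l = z"
    using k(1) l(1) by (simp_all add: Hom_def)
  have "Comp C m (Comp C l k) = m" "Comp C m' (Comp C k l) = m'"
    by (simp_all add: Comp_assoc_arrow[symmetric] k l)
  moreover have "Comp C (Comp C l k) e = e" "Comp C (Comp C k l) e' = e'"
    by (simp_all add: Comp_assoc_arrow k l)
  ultimately have "Comp C l k = Ide C z" "Comp C k l = Ide C z'"
    using diagonal_unique[OF em(1,2), of "Comp C l k" "Ide C z"]
      diagonal_unique[OF em(3,4), of "Comp C k l" "Ide C z'"] by simp_all
  then have "iso_arrow C k"
    using l by (auto simp: iso_arrow_def)
  with k show ?thesis
    using that by blast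
qed

text \<open>Factor \<open>i \<rightarrow> y\<close> as \<open>i \<twoheadrightarrow> w \<rightarrowtail> y\<close> and then \<open>w \<rightarrow> t\<close> as \<open>w \<twoheadrightarrow> v \<rightarrowtail> t\<close>: then \<open>v\<close> factors
  \<open>i \<rightarrow> t\<close>, hence is isomorphic to \<open>z\<close>, and \<open>z\<close> is a quotient of the subobject \<open>w\<close> of \<open>y\<close>.\<close>

lemma minimal_factorization_initial_final:
  assumes i: "initial C i" and t: "final C t" and u: "u \<in> Hom C i t"
    and fact: "is_factorization C E M u e z m"
  shows "minimal C E M z"
  unfolding minimal_def
proof (intro conjI ballI)
  show "z \<in> Ob C"
    using fact Cod_in_Ob[of e] by (auto simp: is_factorization_def Hom_def)
  fix y assume "y \<in> Ob C"
  then obtain f where "f \<in> Hom C i y"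
    using i by (auto simp: initial_def)
  then obtain e1 w m1 where 1: "e1 \<in> E" "e1 \<in> Hom C i w" "m1 \<in> M" "m1 \<in> Hom C w y"
    using factorization_exists[of f] by (auto simp: is_factorization_def Hom_def)
  have w: "w \<in> Ob C"
    using 1 Cod_in_Ob[of e1] by (auto simp: Hom_def)
  then obtain g where "g \<in> Hom C w t"
    using t by (auto simp: final_def)
  then obtain e2 v m2 where 2: "e2 \<in> E" "e2 \<in> Hom C w v" "m2 \<in> M" "m2 \<in> Hom C v t"
    using factorization_exists[of g] by (auto simp: is_factorization_def Hom_def)
  have "Comp C m2 (Comp C e2 e1) \<in> Hom C i t"
    using 1 2 by (auto simp: Hom_def)
  moreover have "\<exists>!u. u \<in> Hom C i t"
    using i t by (auto simp: initial_def final_def)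
  ultimately have "u = Comp C m2 (Comp C e2 e1)"
    using u by blast
  then have "is_factorization C E M u (Comp C e2 e1) v m2"
    using 1 2 u E_Comp by (auto simp: is_factorization_def Hom_def)
  from factorization_iso[OF this fact] obtain k where "k \<in> Hom C v z" "iso_arrow C k" .
  then have "Comp C k e2 \<in> E" "Comp C k e2 \<in> Hom C w z"
    using 2 E_iso E_Comp by (auto simp: Hom_def)
  with 1 w show "divides C E M z y"
    unfolding divides_def by blast
qed

end

section \<open>The componentwise factorization system on automata\<close>

locale language_factorization = language I C S L + factorization_system C E M
  for I :: "('io, 'ia) cat" and C :: "('co, 'ca) cat" and S L E M
begin

abbreviation auto_E :: "('io, 'ia, 'co, 'ca) ntrans set" where
  "auto_E \<equiv> auto_class (full_subcat I S) I (inclusion (full_subcat I S)) C L E"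

abbreviation auto_M :: "('io, 'ia, 'co, 'ca) ntrans set" where
  "auto_M \<equiv> auto_class (full_subcat I S) I (inclusion (full_subcat I S)) C L M"

lemma auto_class_iff:
  "\<alpha> \<in> auto_class (full_subcat I S) I (inclusion (full_subcat I S)) C L X \<longleftrightarrow>
    \<alpha> \<in> Ar aut \<and> (\<forall>x \<in> Ob I. NComp \<alpha> x \<in> X)"
  by (simp add: auto_class_def)

lemma iso_arrow_component:
  assumes "iso_arrow aut \<alpha>" and x: "x \<in> Ob I"
  shows "iso_arrow C (NComp \<alpha> x)"
proof -
  obtain \<beta> where \<alpha>: "\<alpha> \<in> Ar aut" and \<beta>: "\<beta> \<in> Ar aut" "NDom \<beta> = NCod \<alpha>" "NCod \<beta> = NDom \<alpha>"
    and eq: "Comp aut \<beta> \<alpha> = Ide aut (NDom \<alpha>)" "Comp aut \<alpha> \<beta> = Ide aut (NCod \<alpha>)"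
    using assms by (auto simp: iso_arrow_def Hom_def)
  have "Comp C (NComp \<beta> x) (NComp \<alpha> x) = Ide C (FOb (NDom \<alpha>) x)"
    "Comp C (NComp \<alpha> x) (NComp \<beta> x) = Ide C (FOb (NCod \<alpha>) x)"
    using eq[THEN arg_cong[where f = "\<lambda>\<gamma>. NComp \<gamma> x"]] x by simp_all
  then show ?thesis
    using Ar_aut_component[OF \<alpha> x] Ar_aut_component[OF \<beta>(1) x] \<beta>
    by (auto simp: iso_arrow_def Hom_def)
qed

lemma auto_factorization:
  assumes \<alpha>: "\<alpha> \<in> Ar aut"
  shows "\<exists>\<epsilon> Z \<mu>. is_factorization aut auto_E auto_M \<alpha> \<epsilon> Z \<mu>"
proof -
  define A B t where "A = NDom \<alpha>" "B = NCod \<alpha>" "t = NComp \<alpha>"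
  have ext: "extends_L A" "extends_L B" and t: "natural_family I C A B t"
    and tS: "\<And>x. x \<in> S \<Longrightarrow> t x = Ide C (FOb L x)"
    using \<alpha> by (auto simp: Ar_aut A_B_t_def)
  interpret A: cat_functor I C A using ext(1) by (rule extends_L_functor)
  interpret B: cat_functor I C B using ext(2) by (rule extends_L_functor)
  note t_arrow [simp] = natural_family_arrow[OF t]
  \<comment> \<open>A factorization determines its middle object only up to isomorphism, while
    acceptance demands equality. Over \<open>S\<close> the component is an identity, and identities
    belong to both classes, so the trivial factorization is available.\<close>
  have "\<exists>e z m. is_factorization C E M (t x) e z m \<and>
      (x \<in> S \<longrightarrow> e = Ide C (FOb L x) \<and> z = FOb L x \<and> m = Ide C (FOb L x))"
    if x: "x \<in> Ob I" for x
  proof (cases "x \<in> S")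
    case True
    then have "is_factorization C E M (t x) (Ide C (FOb L x)) (FOb L x) (Ide C (FOb L x))"
      by (auto simp: is_factorization_def Hom_def tS E_iso M_iso C.iso_arrow_Ide)
    with True show ?thesis by blast
  next
    case False
    then show ?thesis
      using factorization_exists[of "t x"] x by simp
  qed
  then obtain e z m where fact: "\<And>x. x \<in> Ob I \<Longrightarrow> is_factorization C E M (t x) (e x) (z x) (m x)"
    and S: "\<And>x. x \<in> S \<Longrightarrow> e x = Ide C (FOb L x)" "\<And>x. x \<in> S \<Longrightarrow> z x = FOb L x"
      "\<And>x. x \<in> S \<Longrightarrow> m x = Ide C (FOb L x)"
    by (metis S_Ob)
  have em [simp]: "e x \<in> E" "m x \<in> M" "e x \<in> Ar C" "m x \<in> Ar C" "Cod C (e x) = z x"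
      "Dom C (m x) = z x" if "x \<in> Ob I" for x
    using fact[OF that] unfolding is_factorization_def Hom_def by blast+
  have em' [simp]: "Dom C (e x) = FOb A x" "Cod C (m x) = FOb B x" if "x \<in> Ob I" for x
  proof -
    have "Dom C (e x) = Dom C (t x)" "Cod C (m x) = Cod C (t x)"
      using fact[OF that] unfolding is_factorization_def Hom_def by blast+
    then show "Dom C (e x) = FOb A x" "Cod C (m x) = FOb B x"
      using that by simp_all
  qed
  have me: "Comp C (m x) (e x) = t x" if "x \<in> Ob I" for x
    using fact[OF that] unfolding is_factorization_def by metis
  have z [simp]: "z x \<in> Ob C" if "x \<in> Ob I" for x
    using C.Ob_Dom_Cod(2)[of "e x"] that by simp
  \<comment> \<open>The naturality square of \<open>t\<close> at \<open>h\<close>, with both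
    vertical sides factored, is a lifting problem of \<open>e (Dom I h)\<close> against
    \<open>m (Cod I h)\<close>. Its filler is the transition map of the middle automaton.\<close>
  have "\<exists>d. d \<in> Hom C (z (Dom I h)) (z (Cod I h)) \<and>
      Comp C d (e (Dom I h)) = Comp C (e (Cod I h)) (FAr A h) \<and>
      Comp C (m (Cod I h)) d = Comp C (FAr B h) (m (Dom I h))"
    if h: "h \<in> Ar I" for h
  proof -
    have "Comp C (m (Cod I h)) (Comp C (e (Cod I h)) (FAr A h)) = Comp C (t (Cod I h)) (FAr A h)"
      using h by (simp add: C.Comp_assoc_arrow[symmetric] me)
    also have "\<dots> = Comp C (FAr B h) (t (Dom I h))"
      by (rule natural_family_naturality[OF t h])
    also have "\<dots> = Comp C (Comp C (FAr B h) (m (Dom I h))) (e (Dom I h))"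
      using h by (simp add: C.Comp_assoc_arrow me)
    finally have sq: "Comp C (m (Cod I h)) (Comp C (e (Cod I h)) (FAr A h)) =
        Comp C (Comp C (FAr B h) (m (Dom I h))) (e (Dom I h))" .
    have [simp]: "Cod C (e (Dom I h)) = z (Dom I h)" "Dom C (m (Cod I h)) = z (Cod I h)"
      using h by simp_all
    have "\<exists>!d. d \<in> Hom C (Cod C (e (Dom I h))) (Dom C (m (Cod I h))) \<and>
        Comp C d (e (Dom I h)) = Comp C (e (Cod I h)) (FAr A h) \<and>
        Comp C (m (Cod I h)) d = Comp C (FAr B h) (m (Dom I h))"
      by (rule orthogonality[OF _ _ _ _ sq]) (use h in \<open>auto simp: Hom_def\<close>)
    from ex1_implies_ex[OF this] show ?thesis
      by simp
  qed
  then have "\<forall>h \<in> Ar I. \<exists>d. d \<in> Hom C (z (Dom I h)) (z (Cod I h)) \<and>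
      Comp C d (e (Dom I h)) = Comp C (e (Cod I h)) (FAr A h) \<and>
      Comp C (m (Cod I h)) d = Comp C (FAr B h) (m (Dom I h))"
    by (intro ballI)
  then obtain d where d: "\<forall>h \<in> Ar I. d h \<in> Hom C (z (Dom I h)) (z (Cod I h)) \<and>
      Comp C (d h) (e (Dom I h)) = Comp C (e (Cod I h)) (FAr A h) \<and>
      Comp C (m (Cod I h)) (d h) = Comp C (FAr B h) (m (Dom I h))"
    unfolding bchoice_iff by blast
  have d_arrow [simp]: "d h \<in> Ar C" "Dom C (d h) = z (Dom I h)" "Cod C (d h) = z (Cod I h)"
    if "h \<in> Ar I" for h
    using bspec[OF d that] by (auto simp: Hom_def)
  have de: "Comp C (d h) (e x) = Comp C (e (Cod I h)) (FAr A h)" if "h \<in> Ar I" "x = Dom I h" for h x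
    using bspec[OF d that(1)] that(2) by simp
  have md: "Comp C (m x) (d h) = Comp C (FAr B h) (m (Dom I h))" if "h \<in> Ar I" "x = Cod I h" for h x
    using bspec[OF d that(1)] that(2) by simp
  let ?Z = "\<lparr>FOb = (\<lambda>x \<in> Ob I. z x), FAr = (\<lambda>h \<in> Ar I. d h)\<rparr>"
  have Z: "cat_functor I C ?Z"
  proof (rule cat_functor_arrowI[OF I.category_axioms C.category_axioms])
    fix x assume x: "x \<in> Ob I"
    have "d (Ide I x) = Ide C (z x)"
      by (rule diagonal_unique[of "e x" "m x"])
        (use x de[of "Ide I x" x] md[of "Ide I x" x] in \<open>auto simp: A.FAr_Ide B.FAr_Ide\<close>)
    then show "FAr ?Z (Ide I x) = Ide C (FOb ?Z x)"
      using x by simp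
  next
    fix f g assume fg: "f \<in> Ar I" "g \<in> Ar I" "Dom I g = Cod I f"
    have "d (Comp I g f) = Comp C (d g) (d f)"
    proof (rule diagonal_unique[of "e (Dom I f)" "m (Cod I g)"])
      have "Comp C (Comp C (d g) (d f)) (e (Dom I f)) = Comp C (Comp C (d g) (e (Dom I g))) (FAr A f)"
        using fg by (simp add: C.Comp_assoc_arrow de[of f])
      then show "Comp C (d (Comp I g f)) (e (Dom I f)) = Comp C (Comp C (d g) (d f)) (e (Dom I f))"
        using fg by (simp add: de C.Comp_assoc_arrow A.FAr_Comp_arrow)
      have "Comp C (m (Cod I g)) (Comp C (d g) (d f)) = Comp C (FAr B g) (Comp C (m (Cod I f)) (d f))"
        using fg by (simp add: C.Comp_assoc_arrow[symmetric] md[of g])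
      then show "Comp C (m (Cod I g)) (d (Comp I g f)) = Comp C (m (Cod I g)) (Comp C (d g) (d f))"
        using fg by (simp add: md C.Comp_assoc_arrow B.FAr_Comp_arrow)
    qed (use fg in auto)
    then show "FAr ?Z (Comp I g f) = Comp C (FAr ?Z g) (FAr ?Z f)"
      using fg by simp
  qed (auto simp: Hom_def)
  \<comment> \<open>Over \<open>S\<close> the components of \<open>e\<close> are identities, so the
    upper triangle of the filler identifies it with the action of \<open>A\<close>, which is that of
    \<open>L\<close>.\<close>
  have dS: "d h = FAr L h" if "h \<in> Ar I" "Dom I h \<in> S" "Cod I h \<in> S" for h
    using de[of h "Dom I h"] that ext by (simp add: S extends_L_simps)
  have ext_Z: "extends_L ?Z"
    using Z by (simp add: extends_L_def S dS)
  let ?e = "\<lparr>NDom = A, NCod = ?Z, NComp = restrict e (Ob I)\<rparr>"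
  let ?m = "\<lparr>NDom = ?Z, NCod = B, NComp = restrict m (Ob I)\<rparr>"
  \<comment> \<open>The two triangles of each filler are precisely the naturality squares of
    \<open>e\<close> and \<open>m\<close>.\<close>
  have "?e \<in> Ar aut" "?m \<in> Ar aut"
    using ext ext_Z by (auto simp: Ar_aut natural_family_def Hom_def de md S)
  then have "?e \<in> auto_E \<inter> Hom aut (Dom aut \<alpha>) ?Z" "?m \<in> auto_M \<inter> Hom aut ?Z (Cod aut \<alpha>)"
    by (simp_all add: auto_class_iff Hom_def A_B_t_def(1,2))
  moreover have "\<alpha> = Comp aut ?m ?e"
    by (rule ntrans_eqI[OF \<alpha> Comp_aut_Ar[OF \<open>?e \<in> Ar aut\<close> \<open>?m \<in> Ar aut\<close>]])
      (simp_all add: A_B_t_def[symmetric] me)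
  ultimately have "is_factorization aut auto_E auto_M \<alpha> ?e ?Z ?m"
    unfolding is_factorization_def by blast
  then show ?thesis by blast
qed

text \<open>The fillers are taken in \<open>C\<close>, one object at a time. Their uniqueness makes
  them natural as well as unique among arrows of automata.\<close>

lemma auto_orthogonality:
  assumes \<epsilon>: "\<epsilon> \<in> auto_E" and \<mu>: "\<mu> \<in> auto_M"
    and u: "u \<in> Hom aut (NDom \<epsilon>) (NDom \<mu>)" and v: "v \<in> Hom aut (NCod \<epsilon>) (NCod \<mu>)"
    and eq: "Comp aut \<mu> u = Comp aut v \<epsilon>"
  shows "\<exists>!\<delta>. \<delta> \<in> Hom aut (NCod \<epsilon>) (NDom \<mu>) \<and> Comp aut \<delta> \<epsilon> = u \<and> Comp aut \<mu> \<delta> = v"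
proof -
  define A B X Y where "A = NDom \<epsilon>" "B = NCod \<epsilon>" "X = NDom \<mu>" "Y = NCod \<mu>"
  note names = A_B_X_Y_def[symmetric]
  have Ar: "\<epsilon> \<in> Ar aut" "\<mu> \<in> Ar aut" "u \<in> Ar aut" "v \<in> Ar aut"
    using \<epsilon> \<mu> u v by (auto simp: auto_class_iff Hom_def)
  have ends: "NDom u = A" "NCod u = X" "NDom v = B" "NCod v = Y"
    using u v by (auto simp: A_B_X_Y_def Hom_aut)
  have ext: "extends_L A" "extends_L B" "extends_L X" "extends_L Y"
    using Ar by (auto simp: Ar_aut A_B_X_Y_def)
  have \<epsilon>t: "natural_family I C A B (NComp \<epsilon>)" and \<mu>t: "natural_family I C X Y (NComp \<mu>)"
    and ut: "natural_family I C A X (NComp u)" and vt: "natural_family I C B Y (NComp v)"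
    using Ar by (simp_all add: Ar_aut names ends)
  note arrows [simp] = natural_family_arrow[OF \<epsilon>t] natural_family_arrow[OF \<mu>t]
    natural_family_arrow[OF ut] natural_family_arrow[OF vt]
  have classes [simp]: "NComp \<epsilon> x \<in> E" "NComp \<mu> x \<in> M" if "x \<in> Ob I" for x
    using \<epsilon> \<mu> that by (auto simp: auto_class_iff)
  have eq': "Comp C (NComp \<mu> x) (NComp u x) = Comp C (NComp v x) (NComp \<epsilon> x)" if "x \<in> Ob I" for x
    using eq[THEN arg_cong[where f = "\<lambda>\<gamma>. NComp \<gamma> x"]] that by simp
  have "\<exists>d. d \<in> Hom C (FOb B x) (FOb X x) \<and> Comp C d (NComp \<epsilon> x) = NComp u x \<and>
      Comp C (NComp \<mu> x) d = NComp v x" if x: "x \<in> Ob I" for x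
  proof -
    have "\<exists>!d. d \<in> Hom C (Cod C (NComp \<epsilon> x)) (Dom C (NComp \<mu> x)) \<and>
        Comp C d (NComp \<epsilon> x) = NComp u x \<and> Comp C (NComp \<mu> x) d = NComp v x"
      by (rule orthogonality[OF _ _ _ _ eq'[OF x]]) (use x in \<open>auto simp: Hom_def\<close>)
    from ex1_implies_ex[OF this] show ?thesis
      using x by simp
  qed
  then have "\<forall>x \<in> Ob I. \<exists>d. d \<in> Hom C (FOb B x) (FOb X x) \<and> Comp C d (NComp \<epsilon> x) = NComp u x \<and>
      Comp C (NComp \<mu> x) d = NComp v x"
    by (intro ballI)
  then obtain d where d: "\<forall>x \<in> Ob I. d x \<in> Hom C (FOb B x) (FOb X x) \<and>
      Comp C (d x) (NComp \<epsilon> x) = NComp u x \<and> Comp C (NComp \<mu> x) (d x) = NComp v x"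
    unfolding bchoice_iff by blast
  have d_arrow [simp]: "d x \<in> Ar C" "Dom C (d x) = FOb B x" "Cod C (d x) = FOb X x"
    and de: "Comp C (d x) (NComp \<epsilon> x) = NComp u x" and md: "Comp C (NComp \<mu> x) (d x) = NComp v x"
    if "x \<in> Ob I" for x
    using bspec[OF d that] by (auto simp: Hom_def)
  \<comment> \<open>Both sides fill one and the same square, of the component of
    \<open>\<epsilon>\<close> at the source of \<open>h\<close> against that of \<open>\<mu>\<close>
    at its target.\<close>
  have nat: "Comp C (d (Cod I h)) (FAr B h) = Comp C (FAr X h) (d (Dom I h))" if h: "h \<in> Ar I" for h
  proof (rule diagonal_unique[of "NComp \<epsilon> (Dom I h)" "NComp \<mu> (Cod I h)"])
    have "Comp C (Comp C (d (Cod I h)) (FAr B h)) (NComp \<epsilon> (Dom I h)) =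
        Comp C (d (Cod I h)) (Comp C (NComp \<epsilon> (Cod I h)) (FAr A h))"
      using h ext natural_family_naturality[OF \<epsilon>t h] by (simp add: C.Comp_assoc_arrow)
    also have "\<dots> = Comp C (NComp u (Cod I h)) (FAr A h)"
      using h ext by (simp add: C.Comp_assoc_arrow[symmetric] de)
    also have "\<dots> = Comp C (FAr X h) (NComp u (Dom I h))"
      by (rule natural_family_naturality[OF ut h])
    also have "\<dots> = Comp C (Comp C (FAr X h) (d (Dom I h))) (NComp \<epsilon> (Dom I h))"
      using h ext by (simp add: C.Comp_assoc_arrow de)
    finally show "Comp C (Comp C (d (Cod I h)) (FAr B h)) (NComp \<epsilon> (Dom I h)) =
        Comp C (Comp C (FAr X h) (d (Dom I h))) (NComp \<epsilon> (Dom I h))" .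
    have "Comp C (NComp \<mu> (Cod I h)) (Comp C (d (Cod I h)) (FAr B h)) =
        Comp C (NComp v (Cod I h)) (FAr B h)"
      using h ext by (simp add: C.Comp_assoc_arrow[symmetric] md)
    also have "\<dots> = Comp C (FAr Y h) (NComp v (Dom I h))"
      by (rule natural_family_naturality[OF vt h])
    also have "\<dots> = Comp C (Comp C (FAr Y h) (NComp \<mu> (Dom I h))) (d (Dom I h))"
      using h ext by (simp add: C.Comp_assoc_arrow md)
    also have "\<dots> = Comp C (Comp C (NComp \<mu> (Cod I h)) (FAr X h)) (d (Dom I h))"
      using natural_family_naturality[OF \<mu>t h] by simp
    also have "\<dots> = Comp C (NComp \<mu> (Cod I h)) (Comp C (FAr X h) (d (Dom I h)))"
      using h ext by (simp add: C.Comp_assoc_arrow)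
    finally show "Comp C (NComp \<mu> (Cod I h)) (Comp C (d (Cod I h)) (FAr B h)) =
        Comp C (NComp \<mu> (Cod I h)) (Comp C (FAr X h) (d (Dom I h)))" .
  qed (use h ext in simp_all)
  \<comment> \<open>On \<open>S\<close> the upper triangle reads \<open>d x\<close> after an
    identity equals an identity.\<close>
  have dS: "d x = Ide C (FOb L x)" if x: "x \<in> S" for x
  proof -
    have "NComp \<epsilon> x = Ide C (FOb L x)" "NComp u x = Ide C (FOb L x)"
      using Ar(1,3) x unfolding Ar_aut by blast+
    then show ?thesis
      using de[of x] x ext by (simp add: extends_L_simps)
  qed
  let ?\<delta> = "\<lparr>NDom = B, NCod = X, NComp = restrict d (Ob I)\<rparr>"
  have \<delta>: "?\<delta> \<in> Ar aut"
    using ext nat dS by (auto simp: Ar_aut natural_family_def Hom_def)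
  show ?thesis
    unfolding names
  proof (intro ex1I[of _ ?\<delta>] conjI; (elim conjE)?)
    show "?\<delta> \<in> Hom aut B X"
      using \<delta> by (simp add: Hom_def)
    show "Comp aut ?\<delta> \<epsilon> = u"
      by (rule ntrans_eqI[OF Comp_aut_Ar]) (use Ar \<delta> in \<open>simp_all add: names ends de\<close>)
    show "Comp aut \<mu> ?\<delta> = v"
      by (rule ntrans_eqI[OF Comp_aut_Ar]) (use Ar \<delta> in \<open>simp_all add: names ends md\<close>)
  next
    fix \<gamma> assume \<gamma>: "\<gamma> \<in> Hom aut B X" and \<gamma>u: "Comp aut \<gamma> \<epsilon> = u" and \<gamma>v: "Comp aut \<mu> \<gamma> = v"
    have \<gamma>_Ar: "\<gamma> \<in> Ar aut" "NDom \<gamma> = B" "NCod \<gamma> = X"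
      using \<gamma> by (auto simp: Hom_def)
    show "\<gamma> = ?\<delta>"
    proof (rule ntrans_eqI[OF \<gamma>_Ar(1) \<delta>])
      fix x assume x: "x \<in> Ob I"
      note \<gamma>x = Ar_aut_component[OF \<gamma>_Ar(1) x, unfolded \<gamma>_Ar]
      have \<gamma>_eq: "Comp C (NComp \<gamma> x) (NComp \<epsilon> x) = NComp u x" "Comp C (NComp \<mu> x) (NComp \<gamma> x) = NComp v x"
        unfolding \<gamma>u[symmetric] \<gamma>v[symmetric] using x by simp_all
      have "NComp \<gamma> x = d x"
        by (rule diagonal_unique[of "NComp \<epsilon> x" "NComp \<mu> x"])
          (use x \<gamma>x in \<open>simp_all add: de md \<gamma>_eq\<close>)
      then show "NComp \<gamma> x = NComp ?\<delta> x"
        using x by simp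
    qed (use \<gamma>_Ar in simp_all)
  qed
qed

lemma factorization_system_aut: "factorization_system aut auto_E auto_M"
proof -
  interpret aut: category aut
    by (rule category_aut)
  show ?thesis
  proof unfold_locales
    show "auto_E \<subseteq> Ar aut" "auto_M \<subseteq> Ar aut"
      by (auto simp: auto_class_iff)
    show "f \<in> auto_E" "f \<in> auto_M" if "iso_arrow aut f" for f
      using that iso_arrow_component[OF that] E_iso M_iso
      by (auto simp: auto_class_iff iso_arrow_def[of aut])
    show "Comp aut g f \<in> auto_E" if "f \<in> auto_E" "g \<in> auto_E" "Cod aut f = Dom aut g" for f g
      using that Comp_aut_Ar[of f g] by (auto simp: auto_class_iff Ar_aut_component intro!: E_Comp)
    show "Comp aut g f \<in> auto_M" if "f \<in> auto_M" "g \<in> auto_M" "Cod aut f = Dom aut g" for f g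
      using that Comp_aut_Ar[of f g] by (auto simp: auto_class_iff Ar_aut_component intro!: M_Comp)
    show "\<exists>e z m. is_factorization aut auto_E auto_M f e z m" if "f \<in> Ar aut" for f
      by (rule auto_factorization[OF that])
    show "\<exists>!d. d \<in> Hom aut (Cod aut e) (Dom aut m) \<and> Comp aut d e = u \<and> Comp aut m d = v"
      if "e \<in> auto_E" "m \<in> auto_M" "u \<in> Hom aut (Dom aut e) (Dom aut m)"
        "v \<in> Hom aut (Cod aut e) (Cod aut m)" "Comp aut m u = Comp aut v e" for e m u v
      using auto_orthogonality[OF that(1,2)] that(3-5) by (simp only: aut_simps(1,2))
  qed
qed

end

text \<open>The clauses on Kan extensions cover all that lie in the category of automata, with any
  unit or counit; the two existence clauses keep them from being vacuous. Likewise minimality is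
  asserted for every factorization of the unique arrow, and existence of one is a separate
  clause.\<close>

theorem corollary2p10:
  fixes U :: "'u set"
    and \<I> \<O> :: "('io, 'ia) cat" and S :: "'io set"
    and \<iota> :: "('io, 'ia, 'io, 'ia) func"
    and \<C> :: "('co, 'ca) cat" and \<E> \<M> :: "'ca set"
    and \<L> :: "('io, 'ia, 'co, 'ca) func"
  defines "\<O> \<equiv> full_subcat \<I> S"
    and "\<iota> \<equiv> inclusion \<O>"
  defines "Auto\<L> \<equiv> Auto \<O> \<I> \<iota> \<C> \<L>"
    and "\<E>A \<equiv> auto_class \<O> \<I> \<iota> \<C> \<L> \<E>"
    and "\<M>A \<equiv> auto_class \<O> \<I> \<iota> \<C> \<L> \<M>"
  assumes "infinite U"
    and "small_cat U \<I>" and "S \<subseteq> Ob \<I>"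
    and "complete_cat U \<C>" and "cocomplete_cat U \<C>"
    and "factorization_system \<C> \<E> \<M>"
    and "cat_functor \<O> \<C> \<L>"
  shows "factorization_system Auto\<L> \<E>A \<M>A \<and>
    (\<exists>Lan \<in> Ob Auto\<L>. left_kan \<O> \<I> \<C> \<iota> \<L> Lan (Ide (functor_cat \<O> \<C>) \<L>)) \<and>
    (\<exists>Ran \<in> Ob Auto\<L>. right_kan \<O> \<I> \<C> \<iota> \<L> Ran (Ide (functor_cat \<O> \<C>) \<L>)) \<and>
    (\<forall>Lan \<in> Ob Auto\<L>. \<forall>\<eta>. left_kan \<O> \<I> \<C> \<iota> \<L> Lan \<eta> \<longrightarrow> initial Auto\<L> Lan) \<and>
    (\<forall>Ran \<in> Ob Auto\<L>. \<forall>\<epsilon>. right_kan \<O> \<I> \<C> \<iota> \<L> Ran \<epsilon> \<longrightarrow> final Auto\<L> Ran) \<and>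
    (\<forall>Lan \<in> Ob Auto\<L>. \<forall>\<eta>. \<forall>Ran \<in> Ob Auto\<L>. \<forall>\<epsilon>.
      left_kan \<O> \<I> \<C> \<iota> \<L> Lan \<eta> \<and> right_kan \<O> \<I> \<C> \<iota> \<L> Ran \<epsilon> \<longrightarrow>
        (\<exists>!u. u \<in> Hom Auto\<L> Lan Ran) \<and>
        (\<forall>u \<in> Hom Auto\<L> Lan Ran.
          (\<exists>e Min m. is_factorization Auto\<L> \<E>A \<M>A u e Min m) \<and>
          (\<forall>e Min m. is_factorization Auto\<L> \<E>A \<M>A u e Min m \<longrightarrow>
             minimal Auto\<L> \<E>A \<M>A Min)))"
proof -
  interpret C: factorization_system \<C> \<E> \<M> by fact
  interpret language_factorization \<I> \<C> S \<L> \<E> \<M>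
    using assms(7,8,12) C.category_axioms C.factorization_system_axioms
    by (simp add: language_factorization_def language_def language_axioms_def small_cat_def \<O>_def)
  note defs = \<E>A_def \<M>A_def Auto\<L>_def \<iota>_def \<O>_def
  interpret aut: factorization_system aut auto_E auto_M
    by (rule factorization_system_aut)
  \<comment> \<open>The strict extensions serve twice: they witness the existence clauses, and they
    are the reference against which the unit or counit of an arbitrary Kan extension is
    inverted.\<close>
  obtain R where R: "strict_left_extension R"
    using cocomplete_strict_left_extension assms(6,7,10) by blast
  obtain R' where R': "strict_right_extension R'"
    using complete_strict_right_extension assms(6,7,9) by blast
  have initial: "initial aut Lan"
    if "Lan \<in> Ob aut" "left_kan \<O> \<I> \<C> \<iota> \<L> Lan \<eta>" for Lan \<eta>
  proof (rule initial_strict_left_extension[OF strict_left_extension_if_left_kan_family])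
    show "left_kan_family Lan (NComp \<eta>)"
      using that left_kan_iff[of Lan \<eta>] unfolding Ob_aut \<iota>_def \<O>_def by blast
  qed (rule R)
  have final: "final aut Ran"
    if "Ran \<in> Ob aut" "right_kan \<O> \<I> \<C> \<iota> \<L> Ran \<epsilon>" for Ran \<epsilon>
  proof (rule final_strict_right_extension[OF strict_right_extension_if_right_kan_family])
    show "right_kan_family Ran (NComp \<epsilon>)"
      using that right_kan_iff[of Ran \<epsilon>] unfolding Ob_aut \<iota>_def \<O>_def by blast
  qed (rule R')
  have "R \<in> Ob aut" "R' \<in> Ob aut"
    using R R' by (auto simp: Ob_aut strict_left_extension_def strict_right_extension_def)
  then have kan: "\<exists>Lan \<in> Ob aut. left_kan \<O> \<I> \<C> \<iota> \<L> Lan (Ide (functor_cat \<O> \<C>) \<L>)"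
    "\<exists>Ran \<in> Ob aut. right_kan \<O> \<I> \<C> \<iota> \<L> Ran (Ide (functor_cat \<O> \<C>) \<L>)"
    using strict_left_extension_left_kan[OF R] strict_right_extension_right_kan[OF R']
    unfolding \<iota>_def \<O>_def by blast+
  have minimal: "(\<exists>!u. u \<in> Hom aut Lan Ran) \<and>
      (\<forall>u \<in> Hom aut Lan Ran. (\<exists>e Min m. is_factorization aut auto_E auto_M u e Min m) \<and>
        (\<forall>e Min m. is_factorization aut auto_E auto_M u e Min m \<longrightarrow> minimal aut auto_E auto_M Min))"
    if "initial aut Lan" "final aut Ran" for Lan Ran
  proof (intro conjI ballI allI impI)
    show "\<exists>!u. u \<in> Hom aut Lan Ran"
      using that unfolding initial_def final_def by blast
    fix u assume u: "u \<in> Hom aut Lan Ran"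
    then show "\<exists>e Min m. is_factorization aut auto_E auto_M u e Min m"
      by (intro aut.factorization_exists) (simp add: Hom_def)
    show "minimal aut auto_E auto_M Min" if "is_factorization aut auto_E auto_M u e Min m" for e Min m
      by (rule aut.minimal_factorization_initial_final[OF \<open>initial aut Lan\<close> \<open>final aut Ran\<close> u that])
  qed
  have aut_eq: "Auto\<L> = aut" "\<E>A = auto_E" "\<M>A = auto_M"
    by (simp_all only: defs)
  show ?thesis
    unfolding aut_eq
    by (intro conjI factorization_system_aut kan; intro ballI allI impI minimal; (elim conjE)?;
      rule initial final; assumption)
qed

end
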